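(* Let $f:\mathbb{R}^n\to\mathbb{R}$ be $m$-strongly convex with $L$-Lipschitz gradient. Let $(x_k)_{k\ge 0}$ be the iterates of the descent method with Approximately Exact Line Search (defined in the context) with parameters $T_0>0$, $\beta\in(0,1)$ and starting point $x_0$, and assume that each search direction $d_k$ is a descent direction, i.e. $d_k^T\nabla f(x_k)<0$. Then, for all $k$, the following hold. (1) (True gradient.) If $d_k=-\nabla f(x_k)$ for every $k$, then $$f(x_k)-f_*\le\left(1-\beta^2\left(1-\sqrt{1-\tfrac{m}{L}}\right)\right)^k(f(x_0)-f_* ).$$ (2) (Finite differencing.) If $d_k=-g(x_k)$ for every $k$, where $g$ is the $\sigma$-finite differencing gradient approximation with $\sigma=\frac{2\tilde\sigma m\Delta}{L\sqrt n}$ and $0<\tilde\sigma<1$, then $$f(x_{k+1})-f_*\le\min\{A_k,B_k\},$$ where $$A_k=\left(1-\beta^2\left(1-\sqrt{1-\tfrac{m}{L}}\right)\frac{1-\tilde\sigma}{(1+\tilde\sigma)^2}\right)^k(f(x_0)-f_* )+\frac{\tilde\sigma(1+\tilde\sigma)^2\Delta L\|x_0-x_*\|}{(1-\tilde\sigma)^2\beta^2\left(1-\sqrt{1-\frac{m}{L}}\right)},$$ $$B_k=\left(1-\frac{\beta^2}{2}\left(1-\sqrt{1-\tfrac{m}{L}}\right)\frac{1-\tilde\sigma}{(1+\tilde\sigma)^2}\right)^k(f(x_0)-f_* )+\frac{\tilde\sigma^2m(1+\tilde\sigma)^2\Delta^2}{(1-\tilde\sigma)^2\beta^2\left(1-\sqrt{1-\frac{m}{L}}\right)}.$$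 (3) (Random direction.) If $d_k=-\mu_kv_k$ for every $k$, where $v_0,v_1,\dots$ are independent uniformly random unit vectors in $\mathbb{R}^n$ and $\mu_k$ is any approximation of the directional derivative $v_k^T\nabla f(x_k)$ having the correct sign, then $$\mathbb{E}[f(x_k)-f_*]\le\left(1-\frac{\beta^2}{n}\left(1-\sqrt{1-\tfrac{m}{L}}\right)\right)^k(f(x_0)-f_* ).$$
   Context: $\|\cdot\|$ is the Euclidean norm. $f$ is $m$-strongly convex ($m>0$): $f(y)\ge f(x)+\nabla f(x)^T(y-x)+\frac m2\|y-x\|^2$ for all $x,y$. $f$ has $L$-Lipschitz gradient: $\|\nabla f(x)-\nabla f(y)\|\le L\|x-y\|$ for all $x,y$. $f_*=\min f$ and $x_*$ is the minimizer, $f(x_* )=f_*$. $\Delta>0$ is the user-specified tolerance for $\|x-x_*\|$ at termination; it is a standing assumption that $\|x_k-x_*\|\ge\Delta$ during execution of the algorithm. Finite differencing gradient approximation: for $\sigma>0$, $g(x)\in\mathbb{R}^n$ has coordinates $g(x)_i=\frac{f(x+\sigma e_i)-f(x)}{\sigma}$, where $e_i$ are the coordinate unit vectors. Descent method: given $x_0$, $T_0>0$, $\beta\in(0,1)$, set $t_{-1}=T_0$. For $k=0,1,2,\dots$: choose a search direction $d_k$; let $t_k$ be the output of the line search $\mathrm{AELS}(f,x_k,T,\beta,d_k)$ with $T=\beta^{-1}t_{k-1}$; set $x_{k+1}=x_k+t_kd_k$. Approximately Exact Line Search $\mathrm{AELS}(f,x,T,\beta,d)$: 1. Set $t\leftarrow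 T$, $f_{old}\leftarrow f(x)$, $f_{new}\leftarrow f(x+td)$, $\alpha\leftarrow\beta$. If $f_{new}\le f_{old}$, set $\alpha\leftarrow\beta^{-1}$. 2. Repeat $\{t\leftarrow\alpha t;\ f_{old}\leftarrow f_{new};\ f_{new}\leftarrow f(x+td)\}$ until $f_{new}\ge f_{old}$. 3. If $t=T/\beta$: set $t\leftarrow T$, $\alpha\leftarrow\beta$, swap the values of $f_{new}$ and $f_{old}$, and then repeat $\{t\leftarrow\alpha t;\ f_{old}\leftarrow f_{new};\ f_{new}\leftarrow f(x+td)\}$ until $f_{new}>f_{old}$. 4. If $\alpha<1$ return $t$; otherwise return $\beta^2t$. *)

theory Defs
  imports "HOL-Probability.Probability" "HOL-Library.While_Combinator"
begin

definition strongly_convex ::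
  "real \<Rightarrow> ('a::real_inner \<Rightarrow> real) \<Rightarrow> ('a \<Rightarrow> 'a) \<Rightarrow> bool" where
  "strongly_convex m f grad \<longleftrightarrow>
     0 < m \<and> (\<forall>x. GDERIV f x :> grad x) \<and>
     (\<forall>x y. f y \<ge> f x + grad x \<bullet> (y - x) + m / 2 * (norm (y - x))\<^sup>2)"

definition fd_gradient :: "(real ^ 'n \<Rightarrow> real) \<Rightarrow> real \<Rightarrow> real ^ 'n \<Rightarrow> real ^ 'n" where
  "fd_gradient f \<sigma> x = (\<chi> i. (f (x + \<sigma> *\<^sub>R axis i 1) - f x) / \<sigma>)"

(* "repeat c until b": the body is executed at least once.  The result is left unspecified
   (rather than termination being assumed) if the loop does not terminate. *)
definition repeat_until :: "('s \<Rightarrow> 's) \<Rightarrow> ('s \<Rightarrow> bool) \<Rightarrow> 's \<Rightarrow> 's" where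
  "repeat_until c b s = while (\<lambda>s. \<not> b s) c (c s)"

(* Program states are triples (t, f_old, f_new); \<phi> t stands for f (x + t d). *)
fun aels_step :: "(real \<Rightarrow> real) \<Rightarrow> real \<Rightarrow> real \<times> real \<times> real \<Rightarrow> real \<times> real \<times> real" where
  "aels_step \<phi> \<alpha> (t, f_old, f_new) = (\<alpha> * t, f_new, \<phi> (\<alpha> * t))"

definition aels ::
  "('a::real_vector \<Rightarrow> real) \<Rightarrow> 'a \<Rightarrow> real \<Rightarrow> real \<Rightarrow> 'a \<Rightarrow> real" where
  "aels f x T \<beta> d =
     (let \<phi> = (\<lambda>t. f (x + t *\<^sub>R d));
          \<alpha> = (if \<phi> T \<le> f x then 1 / \<beta> else \<beta>);
          (t, f_old, f_new) =
            repeat_until (aels_step \<phi> \<alpha>) (\<lambda>(t, f_old, f_new). f_new \<ge> f_old) (T, f x, \<phi> T);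
          (t, \<alpha>) =
            (if t = T / \<beta>
             then (fst (repeat_until (aels_step \<phi> \<beta>)
                          (\<lambda>(t, f_old, f_new). f_new > f_old) (T, f_new, f_old)), \<beta>)
             else (t, \<alpha>))
      in if \<alpha> < 1 then t else \<beta>\<^sup>2 * t)"

(* The state before iteration k is (x_k, t_{k-1}), with the convention t_{-1} = T0. *)
primrec descent_state ::
  "('a::real_vector \<Rightarrow> real) \<Rightarrow> real \<Rightarrow> real \<Rightarrow> 'a \<Rightarrow> (nat \<Rightarrow> 'a) \<Rightarrow> nat \<Rightarrow> 'a \<times> real" where
  "descent_state f T0 \<beta> x0 d 0 = (x0, T0)"
| "descent_state f T0 \<beta> x0 d (Suc k) =
     (let (x, t_prev) = descent_state f T0 \<beta> x0 d k;
          t = aels f x (t_prev / \<beta>) \<beta> (d k)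
      in (x + t *\<^sub>R d k, t))"

(* The iterate x_k produced by the sequence of search directions d; it depends on d j for
   j < k only, so that rules such as d k = - \<nabla>f (x_k) can be imposed as equations on d. *)
definition iterate ::
  "('a::real_vector \<Rightarrow> real) \<Rightarrow> real \<Rightarrow> real \<Rightarrow> 'a \<Rightarrow> (nat \<Rightarrow> 'a) \<Rightarrow> nat \<Rightarrow> 'a" where
  "iterate f T0 \<beta> x0 d k = fst (descent_state f T0 \<beta> x0 d k)"

(* Uniform (normalised surface) measure on the unit sphere: the radial projection of the
   uniform distribution on the unit ball; sgn x = x / |x|. *)
definition uniform_sphere :: "'a::euclidean_space measure" where
  "uniform_sphere = distr (uniform_measure lborel (cball 0 1)) borel sgn"

(* F k is the information available when iteration k starts.  The direction v k is drawn
   afresh, i.e. independently of F k, and \<mu> k is known at the end of iteration k: it may depend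
   on everything observed so far, on v k and on further randomness, but not on future draws. *)
definition nonanticipating ::
  "'w measure \<Rightarrow> (nat \<Rightarrow> 'w measure) \<Rightarrow> (nat \<Rightarrow> 'w \<Rightarrow> 'a::euclidean_space) \<Rightarrow>
     (nat \<Rightarrow> 'w \<Rightarrow> real) \<Rightarrow> bool" where
  "nonanticipating M F v \<mu> \<longleftrightarrow>
     filtration (space M) F \<and>
     (\<forall>k. subalgebra M (F k) \<and>
          v k \<in> borel_measurable (F (Suc k)) \<and>
          \<mu> k \<in> borel_measurable (F (Suc k)) \<and>
          prob_space.indep_set M {v k -` A \<inter> space M | A. A \<in> sets borel} (sets (F k)))"

end

theory Submission
  imports Defs
begin

text \<open>
  The line search returns a step \<open>t\<close> for which the restriction \<open>\<phi>\<close> of \<open>f\<close> to the search line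
  satisfies \<open>\<phi> (t / \<beta>) \<le> \<phi> t\<close> and \<open>\<phi> (t / \<beta>) \<le> \<phi> (t / \<beta>\<^sup>2)\<close>. By convexity \<open>t\<close> then lies between
  \<open>\<beta>\<^sup>2\<close> times the exact minimiser and the minimiser itself, so a step realises at least the fraction
  \<open>\<beta>\<^sup>2\<close> of the decrease of an exact line search, hence at least
  \<open>\<beta>\<^sup>2 (d \<bullet> \<nabla>f)\<^sup>2 / (2 L |d|\<^sup>2)\<close> by the quadratic upper bound. The Polyak-Lojasiewicz inequality turns
  this into a contraction with rate \<open>1 - \<beta>\<^sup>2 c m / L\<close>, where \<open>c\<close> bounds the squared cosine of the
  angle between \<open>d\<close> and the gradient from below; moreover \<open>1 - sqrt (1 - m / L) \<le> m / L\<close>.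

  For the true gradient \<open>c = 1\<close>. For finite differences the relative error of the gradient is at most
  \<open>\<sigma>'\<close> as long as \<open>|x - x\<^sub>*| \<ge> \<Delta>\<close>, so \<open>c = 1 - \<sigma>'\<^sup>2 \<ge> (1 - \<sigma>') / (1 + \<sigma>')\<^sup>2\<close>; the bound thus
  holds even without the additive error terms. For random directions \<open>(v \<bullet> u)\<^sup>2\<close> has expectation
  \<open>|u|\<^sup>2 / n\<close>, and the current direction is independent of the current iterate.
\<close>

section \<open>The line search on convex functions\<close>

text \<open>One later state satisfying \<open>b\<close> forces termination, since
  \<open>while_option\<close> picks the pass by \<open>LEAST\<close>. Minimality of \<open>k\<close>
  matters too: the test that failed one pass earlier usually supplies the second inequality of the
  bracket.\<close>

lemma repeat_until_terminates:
  assumes "b ((c ^^ Suc n) s)"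
  obtains k where "repeat_until c b s = (c ^^ Suc k) s" "b ((c ^^ Suc k) s)"
    "\<And>j. j < k \<Longrightarrow> \<not> b ((c ^^ Suc j) s)"
proof -
  define k where "k = (LEAST k. b ((c ^^ k) (c s)))"
  have ex: "\<exists>k. b ((c ^^ k) (c s))"
    using assms by (metis funpow.simps(2) funpow_swap1 comp_apply)
  have "repeat_until c b s = (c ^^ k) (c s)"
    using ex by (auto simp: repeat_until_def while_def while_option_def k_def)
  moreover have "b ((c ^^ k) (c s))"
    using ex unfolding k_def by (rule LeastI_ex)
  moreover have "\<not> b ((c ^^ j) (c s))" if "j < k" for j
    using that unfolding k_def by (rule not_less_Least)
  ultimately show ?thesis
    using that[of k] by (simp add: funpow_swap1)
qed

text \<open>After a single pass \<open>f_old\<close> is still the third component of the start,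
  hence the case \<open>k = 0\<close>. In both loops of the line search this component is
  \<open>\<phi> T\<close>.\<close>

lemma aels_step_funpow:
  "(aels_step \<phi> \<alpha> ^^ Suc k) (T, a, b) =
     (\<alpha> ^ Suc k * T, if k = 0 then b else \<phi> (\<alpha> ^ k * T), \<phi> (\<alpha> ^ Suc k * T))"
  by (induction k) (auto simp: mult.assoc)

lemma convex_on_three_point:
  fixes \<phi> :: "real \<Rightarrow> real"
  assumes "convex_on UNIV \<phi>" "0 \<le> t" "t \<le> s" "0 < s"
  shows "\<phi> t \<le> (1 - t / s) * \<phi> 0 + t / s * \<phi> s"
  using convex_onD[OF assms(1), of "t / s" 0 s] assms(2-) by simp

text \<open>\<open>b\<close> is a convex combination of \<open>a\<close> and \<open>c\<close> with
  positive weight \<open>u\<close> on \<open>c\<close>; replacing \<open>\<phi> a\<close> by the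
  larger \<open>\<phi> b\<close> lets that weight be cancelled.\<close>

lemma convex_on_real_mono_right:
  fixes \<phi> :: "real \<Rightarrow> real"
  assumes "convex_on UNIV \<phi>" "a < b" "b \<le> c" "\<phi> a \<le> \<phi> b"
  shows "\<phi> b \<le> \<phi> c"
proof (cases "b = c")
  case False
  with assms have "a < c" by simp
  define u where "u = (b - a) / (c - a)"
  have u: "0 < u" "u \<le> 1" and "u * (c - a) = b - a"
    using assms \<open>a < c\<close> by (auto simp: u_def)
  then have b: "b = (1 - u) * a + u * c" by (simp add: algebra_simps)
  have "\<phi> b \<le> (1 - u) * \<phi> a + u * \<phi> c"
    using convex_onD[OF assms(1), of u a c] u b by simp
  also have "\<dots> \<le> (1 - u) * \<phi> b + u * \<phi> c"
    using u assms(4) by (simp add: mult_left_mono)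
  finally have "u * \<phi> b \<le> u * \<phi> c" by (simp add: algebra_simps)
  then show ?thesis using u by simp
qed simp

lemma convex_on_real_mono_left:
  fixes \<phi> :: "real \<Rightarrow> real"
  assumes "convex_on UNIV \<phi>" "a \<le> b" "b < c" "\<phi> c \<le> \<phi> b"
  shows "\<phi> b \<le> \<phi> a"
proof (cases "a = b")
  case False
  with assms have "a < c" by simp
  define u where "u = (b - a) / (c - a)"
  have u: "0 \<le> u" "u < 1" and "u * (c - a) = b - a"
    using assms \<open>a < c\<close> by (auto simp: u_def)
  then have b: "b = (1 - u) * a + u * c" by (simp add: algebra_simps)
  have "\<phi> b \<le> (1 - u) * \<phi> a + u * \<phi> c"
    using convex_onD[OF assms(1), of u a c] u b by simp
  also have "\<dots> \<le> (1 - u) * \<phi> a + u * \<phi> b"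
    using u assms(4) by (simp add: mult_left_mono)
  finally have "(1 - u) * \<phi> b \<le> (1 - u) * \<phi> a" by (simp add: algebra_simps)
  then show ?thesis using u by simp
qed simp

text \<open>Working with an arbitrary comparison point \<open>s\<close> avoids proving that an exact minimiser exists.\<close>

lemma bracket_sufficient_decrease:
  fixes \<phi> :: "real \<Rightarrow> real"
  assumes cvx: "convex_on UNIV \<phi>" and \<beta>: "0 < \<beta>" "\<beta> < 1" and "0 < t"
    and up: "\<phi> (t / \<beta>) \<le> \<phi> t" and down: "\<phi> (t / \<beta>) \<le> \<phi> (t / \<beta>\<^sup>2)"
    and s: "0 < s" "\<phi> s \<le> \<phi> 0"
  shows "\<phi> t \<le> \<phi> 0 - \<beta>\<^sup>2 * (\<phi> 0 - \<phi> s)"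
proof -
  have b2: "0 < \<beta>\<^sup>2" "\<beta>\<^sup>2 < 1" using \<beta> by (auto simp: power_less_one_iff)
  have t: "t < t / \<beta>" "t / \<beta> < t / \<beta>\<^sup>2"
    using \<beta> \<open>0 < t\<close> by (auto simp: field_simps power2_eq_square)
  \<comment> \<open>The chord from \<open>0\<close> to \<open>r\<close> secures at \<open>t\<close>
    the fraction \<open>t / r\<close> of the decrease at \<open>r\<close>, and on this window the
    fraction is at least \<open>\<beta>\<^sup>2\<close>.\<close>
  have right: "\<phi> t \<le> \<phi> 0 - \<beta>\<^sup>2 * (\<phi> 0 - \<phi> s)"
    if "t \<le> r" "r \<le> t / \<beta>\<^sup>2" "\<phi> r \<le> \<phi> s" for r
  proof -
    have r: "0 < r" using that \<open>0 < t\<close> by simp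
    have "\<beta>\<^sup>2 \<le> t / r" using that r b2 by (simp add: field_simps)
    have "\<phi> t \<le> (1 - t / r) * \<phi> 0 + t / r * \<phi> r"
      using convex_on_three_point[OF cvx, of t r] that r \<open>0 < t\<close> by simp
    also have "\<dots> = \<phi> 0 - t / r * (\<phi> 0 - \<phi> r)" by (simp add: algebra_simps)
    also have "\<dots> \<le> \<phi> 0 - \<beta>\<^sup>2 * (\<phi> 0 - \<phi> s)"
      using \<open>\<beta>\<^sup>2 \<le> t / r\<close> that s b2 r \<open>0 < t\<close> by (intro diff_left_mono mult_mono) auto
    finally show ?thesis .
  qed
  \<comment> \<open>Left of \<open>t\<close> the values are at least \<open>\<phi> t\<close>. Right
    of \<open>t / \<beta>\<^sup>2\<close> they are at least the value at that point, which can
    therefore replace \<open>s\<close> in \<open>right\<close>.\<close>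
  consider "s \<le> t" | "t \<le> s" "s \<le> t / \<beta>\<^sup>2" | "t / \<beta>\<^sup>2 \<le> s" by linarith
  then show ?thesis
  proof cases
    case 1
    have "\<phi> t \<le> \<phi> s"
      by (rule convex_on_real_mono_left[OF cvx 1 t(1) up])
    moreover have "\<beta>\<^sup>2 * (\<phi> 0 - \<phi> s) \<le> 1 * (\<phi> 0 - \<phi> s)"
      using b2 s by (intro mult_right_mono) auto
    ultimately show ?thesis by simp
  next
    case 2
    then show ?thesis using right[of s] by simp
  next
    case 3
    have "\<phi> (t / \<beta>\<^sup>2) \<le> \<phi> s"
      by (rule convex_on_real_mono_right[OF cvx t(2) 3 down])
    then show ?thesis using right[of "t / \<beta>\<^sup>2"] t by simp
  qed
qed

text \<open>The last pass of a loop compares two neighbours on the geometric grid, the pass before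
  it the adjacent pair; together they show that the middle of three grid points has the least value.
  \<open>descent\<close> makes backtracking stop, \<open>coercive\<close> makes forward tracking
  stop.\<close>

lemma aels_bracket:
  fixes f :: "'a::real_vector \<Rightarrow> real"
  defines "\<phi> \<equiv> \<lambda>x d t. f (x + t *\<^sub>R d)"
  assumes cvx: "convex_on UNIV (\<phi> x d)" and cont: "isCont (\<phi> x d) 0"
    and descent: "\<forall>\<^sub>F t in at_right 0. \<phi> x d t < \<phi> x d 0"
    and coercive: "\<forall>\<^sub>F t in at_top. \<phi> x d 0 < \<phi> x d t"
    and \<beta>: "0 < \<beta>" "\<beta> < 1" and "0 < T"
  defines "t \<equiv> aels f x T \<beta> d"
  shows "0 < t" "\<phi> x d (t / \<beta>) \<le> \<phi> x d t" "\<phi> x d (t / \<beta>) \<le> \<phi> x d (t / \<beta>\<^sup>2)"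
proof -
  let ?\<phi> = "\<phi> x d"
  have fx: "?\<phi> 0 = f x" by (simp add: \<phi>_def)
  have to0: "(\<lambda>n. \<beta> ^ n * T) \<longlonglongrightarrow> 0"
    using \<beta> by (intro tendsto_mult_left_zero LIMSEQ_realpow_zero) auto
  \<comment> \<open>Endless backtracking would make the values nonincreasing with limit
    \<open>\<phi> 0\<close>, hence all at least \<open>\<phi> 0\<close>, against the descent just
    right of \<open>0\<close>. Both backtracking loops terminate by this.\<close>
  have shrink: "\<exists>n. ?\<phi> (\<beta> ^ n * T) < ?\<phi> (\<beta> ^ Suc n * T)"
  proof (rule ccontr)
    assume "\<not> ?thesis"
    then have dec: "decseq (\<lambda>n. ?\<phi> (\<beta> ^ n * T))"
      by (simp add: decseq_Suc_iff not_less)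
    have lim: "(\<lambda>n. ?\<phi> (\<beta> ^ n * T)) \<longlonglongrightarrow> ?\<phi> 0"
      using isCont_tendsto_compose[OF cont to0] .
    have "filterlim (\<lambda>n. \<beta> ^ n * T) (at_right 0) sequentially"
      using to0 \<beta> \<open>0 < T\<close> by (auto simp: filterlim_at)
    with descent have "\<forall>\<^sub>F n in sequentially. ?\<phi> (\<beta> ^ n * T) < ?\<phi> 0"
      by (auto dest: eventually_compose_filterlim)
    then obtain n where "?\<phi> (\<beta> ^ n * T) < ?\<phi> 0"
      using eventually_happens'[OF sequentially_bot] by blast
    moreover have "?\<phi> 0 \<le> ?\<phi> (\<beta> ^ n * T)"
      by (rule decseq_ge[OF dec lim])
    ultimately show False by simp
  qed
  have bk: "\<beta> * (\<beta> ^ n * T) = \<beta> ^ Suc n * T" for n by simp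
  have "0 < t \<and> ?\<phi> (t / \<beta>) \<le> ?\<phi> t \<and> ?\<phi> (t / \<beta>) \<le> ?\<phi> (t / \<beta>\<^sup>2)"
  proof (cases "?\<phi> T \<le> f x")
    case False
    let ?b = "\<lambda>(t, f_old, f_new). (f_new::real) \<ge> f_old"
    let ?s = "(T, f x, ?\<phi> T)"
    obtain n where n: "?\<phi> (\<beta> ^ n * T) < ?\<phi> (\<beta> ^ Suc n * T)" using shrink ..
    then have "?b ((aels_step ?\<phi> \<beta> ^^ Suc n) ?s)"
      unfolding aels_step_funpow by (cases n) (simp_all)
    from repeat_until_terminates[where b = ?b, OF this] obtain k
      where k: "repeat_until (aels_step ?\<phi> \<beta>) ?b ?s = (aels_step ?\<phi> \<beta> ^^ Suc k) ?s"
        "?b ((aels_step ?\<phi> \<beta> ^^ Suc k) ?s)"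
        "\<And>j. j < k \<Longrightarrow> \<not> ?b ((aels_step ?\<phi> \<beta> ^^ Suc j) ?s)" by blast
    have step: "?\<phi> (\<beta> ^ k * T) \<le> ?\<phi> (\<beta> ^ Suc k * T)"
      using k(2) unfolding aels_step_funpow by (auto split: if_splits)
    \<comment> \<open>The first backtracking pass cannot be the last: from
      \<open>\<phi> T > \<phi> 0\<close> convexity yields
      \<open>\<phi> (\<beta> * T) < \<phi> T\<close>. So \<open>t / \<beta>\<^sup>2\<close> is at
      most \<open>T\<close> and has been evaluated.\<close>
    have "k \<noteq> 0"
    proof
      assume "k = 0"
      with step have "?\<phi> T \<le> ?\<phi> (\<beta> * T)" by simp
      moreover have "?\<phi> (\<beta> * T) \<le> (1 - \<beta>) * ?\<phi> 0 + \<beta> * ?\<phi> T"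
        using convex_on_three_point[OF cvx, of "\<beta> * T" T] \<beta> \<open>0 < T\<close> by simp
      moreover have "(1 - \<beta>) * ?\<phi> 0 < (1 - \<beta>) * ?\<phi> T"
        using False \<beta> fx by simp
      ultimately show False by (simp add: algebra_simps)
    qed
    then obtain j where j: "k = Suc j" by (cases k) auto
    have prev: "?\<phi> (\<beta> ^ Suc j * T) \<le> ?\<phi> (\<beta> ^ j * T)"
      using k(3)[of j] unfolding aels_step_funpow j by (auto split: if_splits)
    have pos: "0 < \<beta> ^ Suc k * T" using \<beta> \<open>0 < T\<close> by simp
    have "\<beta> ^ Suc k * T < 1 * T"
      using \<beta> \<open>0 < T\<close> by (intro mult_strict_right_mono power_Suc_less_one) auto
    \<comment> \<open>A backtracked step is below \<open>T\<close>, so the test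
      \<open>t = T / \<beta>\<close> fails and no second loop is run.\<close>
    then have "\<beta> ^ Suc k * T \<noteq> T / \<beta>"
      using \<beta> \<open>0 < T\<close> by (smt (verit) divide_less_eq_1 le_divide_eq_1 mult_le_cancel_left1 pos_le_divide_eq)
    then have t: "t = \<beta> ^ Suc k * T"
      using False \<beta> k(1) unfolding t_def aels_def Let_def aels_step_funpow
      by (simp add: \<phi>_def)
    have "t / \<beta> = \<beta> ^ k * T" "t / \<beta>\<^sup>2 = \<beta> ^ j * T"
      using \<beta> by (auto simp: t j field_simps power2_eq_square)
    then show ?thesis using step prev pos t j by simp
  next
    case True
    let ?b = "\<lambda>(t, f_old, f_new). (f_new::real) \<ge> f_old"
    let ?s = "(T, f x, ?\<phi> T)"
    let ?a = "1 / \<beta>"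
    have a: "1 < ?a" using \<beta> by simp
    \<comment> \<open>Endless forward tracking would keep all values below
      \<open>\<phi> T \<le> \<phi> 0\<close> while the step grows to infinity, against
      coercivity.\<close>
    have "\<exists>n. ?\<phi> (?a ^ n * T) \<le> ?\<phi> (?a ^ Suc n * T)"
    proof (rule ccontr)
      assume "\<not> ?thesis"
      then have dec: "decseq (\<lambda>n. ?\<phi> (?a ^ n * T))"
        unfolding decseq_Suc_iff by (meson less_imp_le not_less)
      have "filterlim (\<lambda>n. ?a ^ n * T) at_top sequentially"
      proof (intro filterlim_at_top_mult_tendsto_pos[OF tendsto_const])
        show "filterlim (\<lambda>n. ?a ^ n) at_top sequentially"
          using a filterlim_realpow_sequentially_gt1[of ?a] \<beta>
          by (intro filterlim_at_infinity_imp_filterlim_at_top) auto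
      qed (fact \<open>0 < T\<close>)
      with coercive have "\<forall>\<^sub>F n in sequentially. ?\<phi> 0 < ?\<phi> (?a ^ n * T)"
        by (auto dest: eventually_compose_filterlim)
      then obtain n where "?\<phi> 0 < ?\<phi> (?a ^ n * T)"
        using eventually_happens'[OF sequentially_bot] by blast
      moreover have "?\<phi> (?a ^ n * T) \<le> ?\<phi> T"
        using decseqD[OF dec, of 0 n] by simp
      ultimately show False using True fx by simp
    qed
    then obtain n where n: "?\<phi> (?a ^ n * T) \<le> ?\<phi> (?a ^ Suc n * T)" ..
    then have "?b ((aels_step ?\<phi> ?a ^^ Suc n) ?s)"
      unfolding aels_step_funpow by (cases n) (simp_all)
    from repeat_until_terminates[where b = ?b, OF this] obtain k
      where k: "repeat_until (aels_step ?\<phi> ?a) ?b ?s = (aels_step ?\<phi> ?a ^^ Suc k) ?s"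
        "?b ((aels_step ?\<phi> ?a ^^ Suc k) ?s)"
        "\<And>j. j < k \<Longrightarrow> \<not> ?b ((aels_step ?\<phi> ?a ^^ Suc j) ?s)" by blast
    have step: "?\<phi> (?a ^ k * T) \<le> ?\<phi> (?a ^ Suc k * T)"
      using k(2) unfolding aels_step_funpow by (auto split: if_splits)
    show ?thesis
    \<comment> \<open>The point reached equals \<open>T / \<beta>\<close> exactly when forward
      tracking stops after one pass, that is for \<open>k = 0\<close>. Otherwise the factor
      \<open>\<beta>\<^sup>2\<close> moves two grid points back from the last one.\<close>
    proof (cases k)
      case (Suc j)
      have prev: "?\<phi> (?a ^ Suc j * T) \<le> ?\<phi> (?a ^ j * T)"
        using k(3)[of j] unfolding aels_step_funpow Suc by (auto split: if_splits)
      have "1 < ?a ^ Suc j" using a by (intro power_gt1)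
      then have "?a ^ Suc k * T \<noteq> T / \<beta>"
        using \<open>0 < T\<close> \<beta> unfolding Suc by (simp add: field_simps)
      then have t: "t = \<beta>\<^sup>2 * (?a ^ Suc k * T)"
        using True \<beta> k(1) unfolding t_def aels_def Let_def aels_step_funpow
        by (simp add: \<phi>_def)
      have "t = ?a ^ j * T" "t / \<beta> = ?a ^ k * T" "t / \<beta>\<^sup>2 = ?a ^ Suc k * T"
        using \<beta> by (auto simp: t Suc field_simps power2_eq_square)
      then show ?thesis using step prev Suc \<beta> \<open>0 < T\<close> by simp
    next
      case 0
      let ?c = "\<lambda>(t, f_old, f_new). (f_new::real) > f_old"
      \<comment> \<open>The state after the swap: \<open>f_old\<close> holds the value at
        \<open>T / \<beta>\<close>, \<open>f_new\<close> the value at \<open>T\<close>.\<close>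
      let ?r = "(T, ?\<phi> (T / \<beta>), ?\<phi> T)"
      have "\<exists>n. ?c ((aels_step ?\<phi> \<beta> ^^ Suc n) ?r)"
      proof -
        obtain n where n: "?\<phi> (\<beta> ^ n * T) < ?\<phi> (\<beta> ^ Suc n * T)" using shrink ..
        then show ?thesis
          by (intro exI[of _ n], unfold aels_step_funpow, cases n) simp_all
      qed
      then obtain n where "?c ((aels_step ?\<phi> \<beta> ^^ Suc n) ?r)" ..
      from repeat_until_terminates[where b = ?c, OF this] obtain i
        where i: "repeat_until (aels_step ?\<phi> \<beta>) ?c ?r = (aels_step ?\<phi> \<beta> ^^ Suc i) ?r"
          "?c ((aels_step ?\<phi> \<beta> ^^ Suc i) ?r)"
          "\<And>j. j < i \<Longrightarrow> \<not> ?c ((aels_step ?\<phi> \<beta> ^^ Suc j) ?r)" by blast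
      have step': "?\<phi> (\<beta> ^ i * T) \<le> ?\<phi> (\<beta> ^ Suc i * T)"
        using i(2) unfolding aels_step_funpow by (auto split: if_splits)
      have t: "t = \<beta> ^ Suc i * T"
        using True \<beta> k(1) i(1) unfolding t_def aels_def Let_def 0 aels_step_funpow
        by (simp add: \<phi>_def)
      \<comment> \<open>If the second loop stops after one pass, \<open>t / \<beta>\<^sup>2\<close>
        is the abandoned forward point \<open>T / \<beta>\<close>, and the missing comparison is the
        exit test of the first loop.\<close>
      have "?\<phi> (\<beta> ^ i * T) \<le> ?\<phi> (t / \<beta>\<^sup>2)"
      proof (cases i)
        case 0
        then show ?thesis
          using step \<beta> \<open>k = 0\<close> by (simp add: t power2_eq_square field_simps)
      next
        case (Suc j)
        have "t / \<beta>\<^sup>2 = \<beta> ^ j * T" using \<beta> by (simp add: t Suc power2_eq_square field_simps)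
        then show ?thesis using i(3)[of j] unfolding aels_step_funpow Suc
          by (auto split: if_splits)
      qed
      moreover have "t / \<beta> = \<beta> ^ i * T" using \<beta> by (simp add: t)
      ultimately show ?thesis using step' t \<beta> \<open>0 < T\<close> by simp
    qed
  qed
  then show "0 < t" "?\<phi> (t / \<beta>) \<le> ?\<phi> t" "?\<phi> (t / \<beta>) \<le> ?\<phi> (t / \<beta>\<^sup>2)" by auto
qed

section \<open>Smooth strongly convex functions\<close>

locale smooth_strongly_convex =
  fixes f :: "'a::euclidean_space \<Rightarrow> real" and grad :: "'a \<Rightarrow> 'a" and m L :: real and xs :: 'a
  assumes sc: "strongly_convex m f grad"
    and lip: "L-lipschitz_on UNIV grad"
    and minimizer: "is_arg_min f (\<lambda>_. True) xs"
begin

lemma m_pos: "0 < m"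
  using sc by (simp add: strongly_convex_def)

lemma f_min: "f xs \<le> f x"
  using minimizer by (auto simp: is_arg_min_def not_less)

lemma quadratic_lower: "f x + grad x \<bullet> (y - x) + m / 2 * (norm (y - x))\<^sup>2 \<le> f y"
  using sc by (simp add: strongly_convex_def)

lemma f_has_derivative: "(f has_derivative (\<lambda>h. h \<bullet> grad x)) (at x)"
  using sc by (simp add: strongly_convex_def gderiv_def)

lemma continuous_f: "continuous_on S f"
  by (meson continuous_at_imp_continuous_on f_has_derivative has_derivative_continuous)

lemma continuous_grad: "continuous_on S grad"
  using lip by (meson continuous_on_subset lipschitz_on_continuous_on subset_UNIV)

lemma line_deriv: "((\<lambda>t. f (x + t *\<^sub>R h)) has_real_derivative grad (x + t *\<^sub>R h) \<bullet> h) (at t)"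
proof -
  have "((\<lambda>t. x + t *\<^sub>R h) has_derivative (\<lambda>t. t *\<^sub>R h)) (at t)"
    by (auto intro!: derivative_eq_intros)
  from has_derivative_compose[OF this f_has_derivative] show ?thesis
    by (simp add: has_field_derivative_def inner_commute mult.commute[of _ "_ \<bullet> _"] mult_commute_abs)
qed

text \<open>The gap between the two sides, followed along the segment as \<open>q\<close>, has
  nonpositive derivative by Cauchy-Schwarz and the Lipschitz bound.\<close>

lemma quadratic_upper: "f y \<le> f x + grad x \<bullet> (y - x) + L / 2 * (norm (y - x))\<^sup>2"
proof -
  define h where "h = y - x"
  define q where "q = (\<lambda>t. f (x + t *\<^sub>R h) - t * (grad x \<bullet> h) - L / 2 * t\<^sup>2 * (norm h)\<^sup>2)"
  have "q 1 \<le> q 0"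
  proof (rule DERIV_nonpos_imp_nonincreasing[where f = q])
    fix t :: real assume t: "0 \<le> t" "t \<le> 1"
    have "(q has_real_derivative grad (x + t *\<^sub>R h) \<bullet> h - grad x \<bullet> h - L * t * (norm h)\<^sup>2) (at t)"
      unfolding q_def by (rule derivative_eq_intros line_deriv refl | simp)+
    moreover have "grad (x + t *\<^sub>R h) \<bullet> h - grad x \<bullet> h \<le> L * t * (norm h)\<^sup>2"
    proof -
      have "grad (x + t *\<^sub>R h) \<bullet> h - grad x \<bullet> h \<le> norm (grad (x + t *\<^sub>R h) - grad x) * norm h"
        by (metis inner_diff_left norm_cauchy_schwarz)
      also have "\<dots> \<le> L * norm (t *\<^sub>R h) * norm h"
        using lipschitz_onD[OF lip, of "x + t *\<^sub>R h" x]
        by (intro mult_right_mono) (auto simp: dist_norm)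
      finally show ?thesis using t by (simp add: power2_eq_square mult_ac)
    qed
    ultimately show "\<exists>y. (q has_real_derivative y) (at t) \<and> y \<le> 0"
      by (intro exI conjI) auto
  qed simp
  then show ?thesis by (simp add: q_def h_def)
qed

text \<open>At a unit vector, the two quadratic bounds around \<open>0\<close> differ only in
  \<open>m\<close> and \<open>L\<close>.\<close>

lemma m_le_L: "m \<le> L"
proof -
  obtain b :: 'a where "b \<in> Basis" using nonempty_Basis by blast
  then have "norm b = 1" by simp
  then show ?thesis
    using quadratic_lower[of 0 b] quadratic_upper[of b 0] by simp
qed

lemma L_pos: "0 < L"
  using m_pos m_le_L by simp

lemma ratio_bounds: "0 < m / L" "m / L \<le> 1"
  using m_pos m_le_L L_pos by auto

text \<open>A number in the unit interval is at most its square root, applied to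
  \<open>1 - m / L\<close>. This weakens the rate \<open>m / L\<close> to the stated one.\<close>

lemma sqrt_rate: "0 < 1 - sqrt (1 - m / L)" "1 - sqrt (1 - m / L) \<le> m / L"
proof -
  have "(1 - m / L)\<^sup>2 \<le> (1 - m / L) * 1"
    unfolding power2_eq_square using ratio_bounds by (intro mult_left_mono) auto
  then have "1 - m / L \<le> sqrt (1 - m / L)" by (intro real_le_rsqrt) simp
  then show "1 - sqrt (1 - m / L) \<le> m / L" by simp
  show "0 < 1 - sqrt (1 - m / L)" using ratio_bounds by (simp add: real_less_lsqrt)
qed

text \<open>The step minimises the quadratic upper bound along the line, not \<open>f\<close>
  itself; it serves as the comparison point for the line search.\<close>

lemma line_minimum:
  assumes "d \<noteq> 0"
  shows "f (x + (- (grad x \<bullet> d) / (L * (norm d)\<^sup>2)) *\<^sub>R d) \<le> f x - (d \<bullet> grad x)\<^sup>2 / (2 * L * (norm d)\<^sup>2)"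
proof -
  define a where "a = grad x \<bullet> d"
  define N where "N = (norm d)\<^sup>2"
  have "0 < N" using assms by (simp add: N_def)
  let ?s = "- a / (L * N)"
  have "(norm (?s *\<^sub>R d))\<^sup>2 = ?s\<^sup>2 * N"
    unfolding N_def norm_scaleR power_mult_distrib power2_abs real_norm_def ..
  then have "f (x + ?s *\<^sub>R d) \<le> f x + (?s * a + L / 2 * (?s\<^sup>2 * N))"
    using quadratic_upper[of "x + ?s *\<^sub>R d" x]
    by (simp add: a_def)
  also have "?s * a + L / 2 * (?s\<^sup>2 * N) = - (a\<^sup>2 / (2 * L * N))"
    using L_pos \<open>0 < N\<close> by (simp add: field_simps power2_eq_square)
  finally have "f (x + ?s *\<^sub>R d) \<le> f x - a\<^sup>2 / (2 * L * N)"
    by (simp only: add_uminus_conv_diff)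
  then show ?thesis by (simp add: a_def N_def inner_commute)
qed

text \<open>A gradient step of length \<open>1 / L\<close>, which is \<open>line_minimum\<close> for
  \<open>d = grad x\<close>, cannot go below the minimum. At \<open>xs\<close> this yields a
  vanishing gradient.\<close>

lemma norm_grad_upper: "(norm (grad x))\<^sup>2 \<le> 2 * L * (f x - f xs)"
proof (cases "grad x = 0")
  case False
  have "f xs \<le> f x - (norm (grad x))\<^sup>2 / (2 * L)"
    using line_minimum[OF False, of x] f_min[of "x + (- (grad x \<bullet> grad x) / (L * (norm (grad x))\<^sup>2)) *\<^sub>R grad x"] False
    by (simp add: power2_norm_eq_inner[symmetric] power2_eq_square)
  then show ?thesis using L_pos by (simp add: field_simps)
qed (use f_min[of x] L_pos in simp)

text \<open>Expanding the square of \<open>norm (grad x + m *\<^sub>R h)\<close> produces, as cross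
  and last term, exactly the expression that strong convexity bounds by
  \<open>f xs - f x\<close>.\<close>

lemma polyak_lojasiewicz: "2 * m * (f x - f xs) \<le> (norm (grad x))\<^sup>2"
proof -
  define h where "h = xs - x"
  have "0 \<le> (norm (grad x + m *\<^sub>R h))\<^sup>2" by simp
  also have "\<dots> = (norm (grad x))\<^sup>2 + 2 * m * (grad x \<bullet> h + m / 2 * (norm h)\<^sup>2)"
    by (simp only: power2_norm_eq_inner)
      (simp add: inner_add_left inner_add_right inner_commute algebra_simps)
  also have "\<dots> \<le> (norm (grad x))\<^sup>2 + 2 * m * (f xs - f x)"
    using quadratic_lower[of x xs] m_pos by (intro add_left_mono mult_left_mono) (auto simp: h_def)
  finally show ?thesis by (simp add: algebra_simps)
qed

text \<open>The strong convexity inequalities at \<open>xs\<close> (with zero gradient) and at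
  \<open>x\<close> are added; Cauchy-Schwarz leaves one factor \<open>norm (x - xs)\<close> to
  cancel.\<close>

lemma norm_grad_lower: "m * norm (x - xs) \<le> norm (grad x)"
proof (cases "x = xs")
  case False
  have "grad xs = 0" using norm_grad_upper[of xs] by simp
  then have "f xs + m / 2 * (norm (x - xs))\<^sup>2 \<le> f x"
    using quadratic_lower[of xs x] by simp
  moreover have "f x + grad x \<bullet> (xs - x) + m / 2 * (norm (x - xs))\<^sup>2 \<le> f xs"
    using quadratic_lower[of x xs] by (simp add: norm_minus_commute)
  moreover have "- (grad x \<bullet> (xs - x)) \<le> norm (grad x) * norm (x - xs)"
    using norm_cauchy_schwarz[of "grad x" "x - xs"] by (simp add: inner_diff_right)
  ultimately have "(m * norm (x - xs)) * norm (x - xs) \<le> norm (grad x) * norm (x - xs)"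
    by (simp add: power2_eq_square)
  then show ?thesis using False by simp
qed simp

text \<open>\<open>f\<close> lies above its tangent plane at the intermediate point
  \<open>?z\<close>; in the weighted sum at the two endpoints the gradient terms cancel.\<close>

lemma convex_line: "convex_on UNIV (\<lambda>t. f (x + t *\<^sub>R d))"
proof (rule convex_onI)
  fix u a b :: real assume u: "0 < u" "u < 1"
  let ?a = "x + a *\<^sub>R d" and ?b = "x + b *\<^sub>R d"
  let ?z = "x + ((1 - u) *\<^sub>R a + u *\<^sub>R b) *\<^sub>R d"
  have below: "f ?z + grad ?z \<bullet> (y - ?z) \<le> f y" for y
    using quadratic_lower[of ?z y] m_pos by (smt (verit) mult_nonneg_nonneg zero_le_power2 divide_nonneg_pos)
  have "(1 - u) * (f ?z + grad ?z \<bullet> (?a - ?z)) + u * (f ?z + grad ?z \<bullet> (?b - ?z))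
      \<le> (1 - u) * f ?a + u * f ?b"
    using u by (intro add_mono mult_left_mono below) auto
  moreover have "(1 - u) *\<^sub>R (?a - ?z) + u *\<^sub>R (?b - ?z) = 0"
    by (simp add: algebra_simps)
  then have "(1 - u) * (grad ?z \<bullet> (?a - ?z)) + u * (grad ?z \<bullet> (?b - ?z)) = 0"
    by (metis inner_add_right inner_scaleR_right inner_zero_right)
  ultimately show "f ?z \<le> (1 - u) * f ?a + u * f ?b"
    by (simp add: algebra_simps)
qed simp

lemma aels_decrease:
  assumes d: "d \<bullet> grad x < 0" and "0 < T" "0 < \<beta>" "\<beta> < 1"
  shows "0 < aels f x T \<beta> d"
    and "f (x + aels f x T \<beta> d *\<^sub>R d) \<le> f x - \<beta>\<^sup>2 * ((d \<bullet> grad x)\<^sup>2 / (2 * L * (norm d)\<^sup>2))"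
proof -
  let ?\<phi> = "\<lambda>t. f (x + t *\<^sub>R d)"
  let ?t = "aels f x T \<beta> d"
  have "d \<noteq> 0" using d by auto
  have deriv: "(?\<phi> has_real_derivative grad x \<bullet> d) (at 0)"
    using line_deriv[of x d 0] by simp
  have cont: "isCont ?\<phi> 0" using deriv by (rule DERIV_isCont)
  have descent: "\<forall>\<^sub>F t in at_right 0. ?\<phi> t < ?\<phi> 0"
  proof -
    obtain e where "0 < e" "\<And>h. 0 < h \<Longrightarrow> h < e \<Longrightarrow> ?\<phi> (0 + h) < ?\<phi> 0"
      using DERIV_neg_dec_right[OF deriv] d by (auto simp: inner_commute)
    then show ?thesis by (auto simp: eventually_at_right_field)
  qed
  have coercive: "\<forall>\<^sub>F t in at_top. ?\<phi> 0 < ?\<phi> t"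
  proof -
    \<comment> \<open>\<open>B\<close> is the nonzero step at which the quadratic lower bound
      returns to \<open>f x\<close>; beyond it the bound exceeds \<open>f x\<close>.\<close>
    define B where "B = - 2 * (grad x \<bullet> d) / (m * (norm d)\<^sup>2)"
    have "?\<phi> 0 < ?\<phi> t" if t: "max 0 B < t" for t
    proof -
      have "0 < t" using t by simp
      have "0 < m * (norm d)\<^sup>2" using m_pos \<open>d \<noteq> 0\<close> by simp
      then have "0 < grad x \<bullet> d + m / 2 * t * (norm d)\<^sup>2"
        using t by (simp add: B_def field_simps)
      then have "0 < t * (grad x \<bullet> d + m / 2 * t * (norm d)\<^sup>2)" using \<open>0 < t\<close> by simp
      then show ?thesis
        using quadratic_lower[of x "x + t *\<^sub>R d"]
        by (simp add: power_mult_distrib power2_eq_square algebra_simps)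
    qed
    then show ?thesis unfolding eventually_at_top_dense by blast
  qed
  note bracket = aels_bracket[OF convex_line cont descent coercive \<open>0 < \<beta>\<close> \<open>\<beta> < 1\<close> \<open>0 < T\<close>]
  show "0 < ?t" by (rule bracket(1))
  \<comment> \<open>The step of \<open>line_minimum\<close>, positive because \<open>d\<close> is a
    descent direction, is the comparison point for the bracket.\<close>
  define s where "s = - (grad x \<bullet> d) / (L * (norm d)\<^sup>2)"
  have s: "0 < s" using d L_pos \<open>d \<noteq> 0\<close> by (auto simp: s_def inner_commute intro!: divide_neg_pos)
  have min: "?\<phi> s \<le> f x - (d \<bullet> grad x)\<^sup>2 / (2 * L * (norm d)\<^sup>2)"
    unfolding s_def by (rule line_minimum[OF \<open>d \<noteq> 0\<close>])
  have "?\<phi> s \<le> ?\<phi> 0"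
    using min L_pos by (smt (verit) divide_nonneg_nonneg mult_nonneg_nonneg zero_le_power2 scaleR_zero_left add.right_neutral)
  then have "?\<phi> ?t \<le> ?\<phi> 0 - \<beta>\<^sup>2 * (?\<phi> 0 - ?\<phi> s)"
    using s by (intro bracket_sufficient_decrease[OF convex_line]) (use bracket assms in auto)
  also have "\<dots> \<le> ?\<phi> 0 - \<beta>\<^sup>2 * ((d \<bullet> grad x)\<^sup>2 / (2 * L * (norm d)\<^sup>2))"
    using min by (intro diff_left_mono mult_left_mono) auto
  finally show "f (x + ?t *\<^sub>R d) \<le> f x - \<beta>\<^sup>2 * ((d \<bullet> grad x)\<^sup>2 / (2 * L * (norm d)\<^sup>2))" by simp
qed

end

section \<open>Convergence of the descent method\<close>

locale aels_descent = smooth_strongly_convex f grad m L xs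
  for f :: "'a::euclidean_space \<Rightarrow> real" and grad m L xs +
  fixes T0 \<beta> :: real and x0 :: 'a
  assumes T0: "0 < T0" and \<beta>: "0 < \<beta>" "\<beta> < 1"
begin

abbreviation "iter \<equiv> iterate f T0 \<beta> x0"

lemma iterate_0: "iter d 0 = x0"
  by (simp add: iterate_def)

lemma iterate_Suc:
  "iter d (Suc j) = iter d j + snd (descent_state f T0 \<beta> x0 d (Suc j)) *\<^sub>R d j"
  "snd (descent_state f T0 \<beta> x0 d (Suc j)) =
     aels f (iter d j) (snd (descent_state f T0 \<beta> x0 d j) / \<beta>) \<beta> (d j)"
  by (simp_all add: iterate_def Let_def case_prod_beta)

lemma step_size_pos:
  assumes "\<And>i. i < j \<Longrightarrow> d i \<bullet> grad (iter d i) < 0"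
  shows "0 < snd (descent_state f T0 \<beta> x0 d j)"
  using assms
proof (induction j)
  case 0
  then show ?case using T0 by simp
next
  case (Suc j)
  then show ?case unfolding iterate_Suc(2)
    by (intro aels_decrease(1)) (use \<beta> in auto)
qed

text \<open>Descent is required at all indices up to \<open>j\<close> because the initial trial step
  of iteration \<open>j\<close> inherits its positivity from the earlier searches.\<close>

lemma iterate_decrease:
  assumes "\<And>i. i \<le> j \<Longrightarrow> d i \<bullet> grad (iter d i) < 0"
  shows "f (iter d (Suc j)) \<le> f (iter d j) -
    \<beta>\<^sup>2 * ((d j \<bullet> grad (iter d j))\<^sup>2 / (2 * L * (norm (d j))\<^sup>2))"
  unfolding iterate_Suc
  by (rule aels_decrease(2)) (use assms step_size_pos[of j d] \<beta> in auto)

lemma iterate_le_start: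
  assumes "\<And>i. i < j \<Longrightarrow> d i \<bullet> grad (iter d i) < 0"
  shows "f (iter d j) \<le> f x0"
  using assms
proof (induction j)
  case (Suc j)
  have "0 \<le> \<beta>\<^sup>2 * ((d j \<bullet> grad (iter d j))\<^sup>2 / (2 * L * (norm (d j))\<^sup>2))"
    using L_pos by simp
  then show ?case using iterate_decrease[of j d] Suc by (simp add: less_Suc_eq_le)
qed (simp add: iterate_0)

lemma rate_bounds:
  assumes "0 \<le> c" "c \<le> 1"
  shows "0 \<le> \<beta>\<^sup>2 * c * (1 - sqrt (1 - m / L))" "\<beta>\<^sup>2 * c * (1 - sqrt (1 - m / L)) \<le> 1"
proof -
  show "0 \<le> \<beta>\<^sup>2 * c * (1 - sqrt (1 - m / L))" using assms sqrt_rate(1) by simp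
  have "\<beta>\<^sup>2 * c * (1 - sqrt (1 - m / L)) \<le> 1 * 1 * 1"
    using assms \<beta> sqrt_rate ratio_bounds
    by (intro mult_mono) (auto simp: power_le_one)
  then show "\<beta>\<^sup>2 * c * (1 - sqrt (1 - m / L)) \<le> 1" by simp
qed

text \<open>\<open>c\<close> is a lower bound for the squared cosine between direction and gradient,
  so \<open>iterate_decrease\<close> and \<open>polyak_lojasiewicz\<close> contract the gap by
  \<open>1 - \<beta>\<^sup>2 * c * (m / L)\<close>. After weakening by \<open>sqrt_rate\<close> the
  factor is still nonnegative, which the induction uses.\<close>

lemma linear_rate:
  assumes c: "0 \<le> c" "c \<le> 1"
    and descent: "\<And>i. i < k \<Longrightarrow> d i \<bullet> grad (iter d i) < 0"
    and angle: "\<And>i. i < k \<Longrightarrow>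
      c * ((norm (d i))\<^sup>2 * (norm (grad (iter d i)))\<^sup>2) \<le> (d i \<bullet> grad (iter d i))\<^sup>2"
  shows "f (iter d k) - f xs \<le> (1 - \<beta>\<^sup>2 * c * (1 - sqrt (1 - m / L))) ^ k * (f x0 - f xs)"
  using descent angle
proof (induction k)
  case (Suc k)
  let ?x = "iter d k" and ?r = "1 - \<beta>\<^sup>2 * c * (1 - sqrt (1 - m / L))"
  have "d k \<noteq> 0" using Suc.prems(1)[of k] by auto
  have "c * (1 - sqrt (1 - m / L)) * (f ?x - f xs) \<le> c * (m / L) * (f ?x - f xs)"
    using sqrt_rate c f_min[of ?x] by (intro mult_right_mono mult_left_mono) auto
  also have "\<dots> = c * (2 * m * (f ?x - f xs)) / (2 * L)" using L_pos by simp
  also have "\<dots> \<le> c * (norm (grad ?x))\<^sup>2 / (2 * L)"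
    using polyak_lojasiewicz c L_pos by (intro divide_right_mono mult_left_mono) auto
  also have "\<dots> = c * ((norm (d k))\<^sup>2 * (norm (grad ?x))\<^sup>2) / (2 * L * (norm (d k))\<^sup>2)"
    using \<open>d k \<noteq> 0\<close> by simp
  also have "\<dots> \<le> (d k \<bullet> grad ?x)\<^sup>2 / (2 * L * (norm (d k))\<^sup>2)"
    using Suc.prems(2)[of k] L_pos by (intro divide_right_mono) auto
  finally have "\<beta>\<^sup>2 * (c * (1 - sqrt (1 - m / L)) * (f ?x - f xs))
      \<le> \<beta>\<^sup>2 * ((d k \<bullet> grad ?x)\<^sup>2 / (2 * L * (norm (d k))\<^sup>2))"
    by (intro mult_left_mono) auto
  then have "f (iter d (Suc k)) - f xs \<le> ?r * (f ?x - f xs)"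
    using iterate_decrease[of k d] Suc.prems(1) by (simp add: algebra_simps)
  also have "\<dots> \<le> ?r * (?r ^ k * (f x0 - f xs))"
    using Suc rate_bounds[OF c] by (intro mult_left_mono) auto
  finally show ?case by simp
qed (simp add: iterate_0)

end

section \<open>Accuracy of forward-difference gradients\<close>

lemma perturbed_angle:
  fixes u g :: "'a::real_inner"
  assumes close: "norm (g - u) \<le> s * norm u" and s: "0 \<le> s" "s \<le> 1"
  shows "(1 - s\<^sup>2) * ((norm g)\<^sup>2 * (norm u)\<^sup>2) \<le> (g \<bullet> u)\<^sup>2"
proof -
  define e where "e = g - u"
  define U where "U = u \<bullet> u"
  define p where "p = e \<bullet> u"
  define E where "E = e \<bullet> e"
  have g: "g = u + e" by (simp add: e_def)
  have "(norm e)\<^sup>2 \<le> (s * norm u)\<^sup>2"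
    using close by (intro power_mono) (auto simp: e_def)
  then have E: "E \<le> s\<^sup>2 * U"
    by (simp add: E_def U_def power2_norm_eq_inner power_mult_distrib)
  have s2: "0 \<le> 1 - s\<^sup>2" using s by (simp add: power_le_one)
  have "(1 - s\<^sup>2) * ((norm g)\<^sup>2 * (norm u)\<^sup>2) = (1 - s\<^sup>2) * ((U + 2 * p + E) * U)"
    by (simp add: power2_norm_eq_inner g U_def p_def E_def inner_add_left inner_add_right inner_commute)
  also have "\<dots> \<le> (1 - s\<^sup>2) * ((U + 2 * p + s\<^sup>2 * U) * U)"
    using E s2 by (intro mult_left_mono mult_right_mono) (auto simp: U_def)
  \<comment> \<open>Replacing \<open>E\<close> by \<open>s\<^sup>2 * U\<close> has produced a
    difference of squares. Geometrically, \<open>g\<close> lies in the ball of radius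
    \<open>s * norm u\<close> about \<open>u\<close>, so the sine of the angle is at most
    \<open>s\<close>.\<close>
  also have "\<dots> = (U + p)\<^sup>2 - (p + s\<^sup>2 * U)\<^sup>2" by algebra
  also have "\<dots> \<le> (U + p)\<^sup>2" by simp
  also have "U + p = g \<bullet> u" by (simp add: g U_def p_def inner_add_left)
  finally show ?thesis .
qed

text \<open>Dividing the two quadratic bounds by \<sigma> places the signed error between
  \<open>m * \<sigma> / 2\<close> and \<open>L * \<sigma> / 2\<close>.\<close>

lemma (in smooth_strongly_convex) forward_difference_error:
  assumes "norm e = 1" "0 < \<sigma>"
  shows "\<bar>(f (x + \<sigma> *\<^sub>R e) - f x) / \<sigma> - grad x \<bullet> e\<bar> \<le> L * \<sigma> / 2"
proof -
  have "f (x + \<sigma> *\<^sub>R e) - f x \<le> \<sigma> * (grad x \<bullet> e) + L / 2 * \<sigma>\<^sup>2"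
    using quadratic_upper[of "x + \<sigma> *\<^sub>R e" x] assms by simp
  then have "(f (x + \<sigma> *\<^sub>R e) - f x) / \<sigma> \<le> grad x \<bullet> e + L * \<sigma> / 2"
    using assms by (simp add: field_simps power2_eq_square)
  moreover have "\<sigma> * (grad x \<bullet> e) + m / 2 * \<sigma>\<^sup>2 \<le> f (x + \<sigma> *\<^sub>R e) - f x"
    using quadratic_lower[of x "x + \<sigma> *\<^sub>R e"] assms by simp
  then have "grad x \<bullet> e + m * \<sigma> / 2 \<le> (f (x + \<sigma> *\<^sub>R e) - f x) / \<sigma>"
    using assms by (simp add: field_simps power2_eq_square)
  moreover have "0 \<le> m * \<sigma> / 2" "0 \<le> L * \<sigma> / 2" using m_pos L_pos assms by auto
  ultimately show ?thesis unfolding abs_le_iff by linarith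
qed

lemma fd_gradient_error:
  fixes f :: "real ^ 'n \<Rightarrow> real"
  assumes "smooth_strongly_convex f grad m L xs" "0 < \<sigma>"
  shows "norm (fd_gradient f \<sigma> x - grad x) \<le> L * \<sigma> / 2 * sqrt (real CARD('n))"
proof -
  interpret smooth_strongly_convex f grad m L xs by fact
  have "\<bar>(fd_gradient f \<sigma> x - grad x) $ i\<bar> \<le> L * \<sigma> / 2" for i
    using forward_difference_error[of "axis i 1" \<sigma> x] assms(2)
    by (simp add: fd_gradient_def inner_axis)
  then have "((fd_gradient f \<sigma> x - grad x) $ i)\<^sup>2 \<le> (L * \<sigma> / 2)\<^sup>2" for i
    by (metis abs_ge_zero power2_abs power_mono)
  then have "(\<Sum>i\<in>UNIV. ((fd_gradient f \<sigma> x - grad x) $ i)\<^sup>2) \<le> (\<Sum>i\<in>(UNIV::'n set). (L * \<sigma> / 2)\<^sup>2)"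
    by (rule sum_mono)
  then have "(norm (fd_gradient f \<sigma> x - grad x))\<^sup>2 \<le> real CARD('n) * (L * \<sigma> / 2)\<^sup>2"
    by (simp only: power2_norm_eq_inner inner_vec_def) (simp add: power2_eq_square)
  also have "\<dots> = (L * \<sigma> / 2 * sqrt (real CARD('n)))\<^sup>2"
    by (subst power_mult_distrib) (subst real_sqrt_pow2, simp, rule mult.commute)
  finally show ?thesis
    by (rule power2_le_imp_le) (use L_pos assms(2) in simp)
qed

section \<open>Second moments of the uniform distribution on the sphere\<close>

lemma prod_Basis_cart:
  "(\<Prod>b\<in>Basis. g (b :: real ^ 'n)) = (\<Prod>i\<in>UNIV. g (axis i 1))"
proof -
  have basis: "(Basis :: (real ^ 'n) set) = range (\<lambda>i. axis i 1)" by (auto simp: Basis_vec_def)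
  have "inj (\<lambda>i::'n. axis i (1::real))" by (auto simp: inj_on_def axis_eq_axis)
  then show ?thesis unfolding basis by (subst prod.reindex) simp_all
qed

text \<open>
  Lebesgue measure is invariant under all orthogonal maps, but the library shows this only for
  well-ordered index types. Signed coordinate permutations suffice to compute second moments.
\<close>

definition signed_permute :: "('n \<Rightarrow> 'n) \<Rightarrow> ('n \<Rightarrow> real) \<Rightarrow> real ^ 'n \<Rightarrow> real ^ 'n" where
  "signed_permute p s x = (\<chi> i. s i * x $ p i)"

lemma signed_permute_measurable [measurable]: "signed_permute p s \<in> borel_measurable borel"
  unfolding signed_permute_def[abs_def]
  by (intro borel_measurable_continuous_onI continuous_intros)

text \<open>Lebesgue measure is determined by its values on boxes, and the preimage of a box is a
  box with permuted side lengths.\<close>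

lemma lborel_distr_signed_permute:
  fixes p :: "'n::finite \<Rightarrow> 'n"
  assumes p: "bij p" and s: "\<And>i. \<bar>s i\<bar> = 1"
  shows "distr lborel borel (signed_permute p s) = lborel"
proof (rule lborel_eqI[symmetric])
  fix l u :: "real ^ 'n" assume le: "\<And>b. b \<in> Basis \<Longrightarrow> l \<bullet> b \<le> u \<bullet> b"
  have le': "l $ i \<le> u $ i" for i
    using le[of "axis i 1"] by (simp add: inner_axis)
  define q where "q = inv p"
  have qp: "q (p i) = i" and pq: "p (q i) = i" for i
    using p by (simp_all add: q_def bij_is_inj bij_is_surj surj_f_inv_f)
  have "bij q" using p by (simp add: q_def bij_imp_bij_inv)
  \<comment> \<open>A sign flip pulls the interval from \<open>l\<close> to \<open>u\<close> back to
    the one from \<open>- u\<close> to \<open>- l\<close>; \<open>q\<close> undoes the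
    permutation.\<close>
  define l' where "l' = (\<chi> j. if s (q j) = 1 then l $ q j else - u $ q j)"
  define u' where "u' = (\<chi> j. if s (q j) = 1 then u $ q j else - l $ q j)"
  have s': "s i = 1 \<or> s i = -1" for i using s[of i] by (auto simp: abs_if split: if_splits)
  have "(l $ i < s i * x $ p i \<and> s i * x $ p i < u $ i) \<longleftrightarrow> (l' $ p i < x $ p i \<and> x $ p i < u' $ p i)" for i x
    using s'[of i] by (auto simp: l'_def u'_def qp)
  then have "signed_permute p s -` box l u = box l' u'"
    by (auto simp: mem_box_cart signed_permute_def) (metis pq)+
  then have "emeasure (distr lborel borel (signed_permute p s)) (box l u) = emeasure lborel (box l' u')"
    by (simp add: emeasure_distr)
  also have "\<dots> = (\<Prod>b\<in>Basis. (u' - l') \<bullet> b)"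
    by (rule emeasure_lborel_box)
      (auto simp: Basis_vec_def inner_axis l'_def u'_def le')
  also have "(\<Prod>b\<in>Basis. (u' - l') \<bullet> b) = (\<Prod>j\<in>UNIV. (u - l) $ q j)"
    unfolding prod_Basis_cart by (intro prod.cong) (auto simp: inner_axis l'_def u'_def)
  also have "\<dots> = (\<Prod>i\<in>UNIV. (u - l) $ i)"
    using \<open>bij q\<close> by (rule prod.reindex_bij_betw)
  also have "\<dots> = (\<Prod>b\<in>Basis. (u - l) \<bullet> b)"
    unfolding prod_Basis_cart by (simp add: inner_axis)
  finally show "emeasure (distr lborel borel (signed_permute p s)) (box l u) = (\<Prod>b\<in>Basis. (u - l) \<bullet> b)" .
qed simp

lemma norm_signed_permute:
  fixes p :: "'n::finite \<Rightarrow> 'n"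
  assumes p: "bij p" and s: "\<And>i. \<bar>s i\<bar> = 1"
  shows "norm (signed_permute p s x) = norm x"
proof -
  have "(\<Sum>i\<in>UNIV. (norm (signed_permute p s x $ i))\<^sup>2) = (\<Sum>i\<in>UNIV. (norm (x $ p i))\<^sup>2)"
    using s by (intro sum.cong) (auto simp: signed_permute_def abs_mult)
  also have "\<dots> = (\<Sum>i\<in>UNIV. (norm (x $ i))\<^sup>2)"
    using p by (rule sum.reindex_bij_betw)
  finally show ?thesis by (simp add: norm_vec_def L2_set_def)
qed

lemma borel_measurable_sgn_vec [measurable]: "sgn \<in> borel_measurable (borel :: 'a::euclidean_space measure)"
  unfolding sgn_div_norm[abs_def] by measurable

lemma emeasure_unit_ball:
  "emeasure lborel (cball (0::'a::euclidean_space) 1) \<noteq> 0"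
  "emeasure lborel (cball (0::'a::euclidean_space) 1) \<noteq> \<infinity>"
proof -
  have "0 < measure lborel (cball (0::'a) 1)"
    by (rule content_cball_pos) simp
  then show "emeasure lborel (cball (0::'a) 1) \<noteq> 0"
    by (auto simp: measure_def)
qed (use emeasure_lborel_cball_finite[of "0::'a" 1] in auto)

lemma prob_space_uniform_sphere: "prob_space (uniform_sphere :: 'a::euclidean_space measure)"
  unfolding uniform_sphere_def
  by (intro prob_space.prob_space_distr prob_space_uniform_measure emeasure_unit_ball) simp

lemma sets_uniform_sphere [measurable_cong]: "sets uniform_sphere = sets borel"
  by (simp add: uniform_sphere_def)

text \<open>Since \<open>sgn 0 = 0\<close>, the projection misses the sphere only at the origin, a
  null set.\<close>

lemma AE_uniform_sphere: "AE v in (uniform_sphere :: 'a::euclidean_space measure). norm v = 1"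
proof -
  have "AE x in lborel. x \<noteq> (0::'a)"
    by (rule AE_lborel_singleton)
  then have "AE x in uniform_measure lborel (cball (0::'a) 1). x \<noteq> 0"
    by (intro AE_uniform_measureI) auto
  then have "AE x in uniform_measure lborel (cball (0::'a) 1). norm (sgn x) = 1"
    by eventually_elim (simp add: norm_sgn)
  then show ?thesis
    unfolding uniform_sphere_def by (subst AE_distr_iff) auto
qed

text \<open>A signed permutation preserves Lebesgue measure and the unit ball, and it commutes with
  \<open>sgn\<close>; so the invariance passes from the ball to its radial projection.\<close>

lemma uniform_sphere_signed_permute:
  fixes p :: "'n::finite \<Rightarrow> 'n"
  assumes p: "bij p" and s: "\<And>i. \<bar>s i\<bar> = 1"
  shows "distr uniform_sphere borel (signed_permute p s) = uniform_sphere"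
proof -
  let ?h = "signed_permute p s" and ?C = "cball (0 :: real ^ 'n) 1"
  let ?S = "uniform_measure lborel ?C"
  have ball: "distr ?S borel ?h = ?S"
  proof (rule measure_eqI)
    fix B assume "B \<in> sets (distr ?S borel ?h)"
    then have [measurable]: "B \<in> sets borel" by simp
    have [measurable]: "?h -` B \<in> sets borel" by (rule measurable_sets_borel[OF signed_permute_measurable]) simp
    have eq: "?C \<inter> ?h -` B = ?h -` (?C \<inter> B)"
      using norm_signed_permute[OF assms] by auto
    have "emeasure (distr ?S borel ?h) B = emeasure lborel (?C \<inter> ?h -` B) / emeasure lborel ?C"
      by (simp add: emeasure_distr)
    also have "emeasure lborel (?C \<inter> ?h -` B) = emeasure (distr lborel borel ?h) (?C \<inter> B)"
      unfolding eq by (subst emeasure_distr) auto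
    also have "\<dots> = emeasure lborel (?C \<inter> B)"
      by (simp add: lborel_distr_signed_permute[OF assms])
    finally show "emeasure (distr ?S borel ?h) B = emeasure ?S B" by simp
  qed simp
  have comm: "?h \<circ> sgn = sgn \<circ> ?h"
    by (rule ext) (simp add: vec_eq_iff sgn_div_norm norm_signed_permute[OF assms] signed_permute_def[of _ _ "_ /\<^sub>R _"],
      simp add: signed_permute_def)
  have "distr uniform_sphere borel ?h = distr ?S borel (?h \<circ> sgn)"
    unfolding uniform_sphere_def by (subst distr_distr) auto
  also have "\<dots> = distr (distr ?S borel ?h) borel sgn"
    unfolding comm by (subst distr_distr) auto
  also have "\<dots> = uniform_sphere" by (simp add: ball uniform_sphere_def)
  finally show ?thesis .
qed

lemma integral_uniform_sphere_signed_permute: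
  fixes g :: "real ^ 'n \<Rightarrow> real" and p :: "'n \<Rightarrow> 'n"
  assumes p: "bij p" and s: "\<And>i. \<bar>s i\<bar> = 1" and [measurable]: "g \<in> borel_measurable borel"
  shows "(\<integral>v. g (signed_permute p s v) \<partial>uniform_sphere) = (\<integral>v. g v \<partial>uniform_sphere)"
proof -
  have "(\<integral>v. g (signed_permute p s v) \<partial>uniform_sphere) =
      (\<integral>v. g v \<partial>distr uniform_sphere borel (signed_permute p s))"
    by (rule integral_distr[symmetric]) auto
  then show ?thesis by (simp add: uniform_sphere_signed_permute[OF p s])
qed

lemma abs_component_product_le:
  fixes x :: "real ^ 'n"
  shows "\<bar>x $ a * x $ b\<bar> \<le> (norm x)\<^sup>2"
  unfolding abs_mult power2_eq_square by (intro mult_mono component_le_norm_cart) auto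

lemma integrable_uniform_sphere_component:
  "integrable (uniform_sphere :: (real ^ 'n) measure) (\<lambda>v. v $ a * v $ b)"
proof -
  interpret prob_space "uniform_sphere :: (real ^ 'n) measure" by (rule prob_space_uniform_sphere)
  have "AE v in (uniform_sphere :: (real ^ 'n) measure). norm (v $ a * v $ b) \<le> 1"
    using AE_uniform_sphere
  proof eventually_elim
    case (elim v)
    then show ?case using abs_component_product_le[of v a b] by simp
  qed
  then show ?thesis by (intro integrable_const_bound[of _ 1]) auto
qed

text \<open>Flipping the sign of coordinate \<open>a\<close> negates a mixed moment, which must
  vanish. Swapping coordinates makes all pure moments equal, and they sum to the expectation of the
  squared norm, which is one.\<close>

lemma uniform_sphere_second_moment:
  "(\<integral>v. v $ a * v $ b \<partial>(uniform_sphere :: (real ^ 'n) measure)) =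
     (if a = b then 1 / real CARD('n) else 0)"
proof (cases "a = b")
  case False
  have "(\<integral>v. signed_permute id (\<lambda>i. if i = a then -1 else 1) v $ a *
      signed_permute id (\<lambda>i. if i = a then -1 else 1) v $ b \<partial>(uniform_sphere :: (real ^ 'n) measure)) =
      (\<integral>v. v $ a * v $ b \<partial>uniform_sphere)"
    by (rule integral_uniform_sphere_signed_permute[OF bij_id]) auto
  then show ?thesis using False by (simp add: signed_permute_def)
next
  case True
  interpret prob_space "uniform_sphere :: (real ^ 'n) measure" by (rule prob_space_uniform_sphere)
  have same: "(\<integral>v. v $ c * v $ c \<partial>(uniform_sphere :: (real ^ 'n) measure)) =
      (\<integral>v. v $ a * v $ a \<partial>uniform_sphere)" for c
  proof -
    have "bij (\<lambda>i. if i = a then c else if i = c then a else i)"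
      by (rule involuntory_imp_bij) auto
    then have "(\<integral>v. signed_permute (\<lambda>i. if i = a then c else if i = c then a else i) (\<lambda>i. 1) v $ a *
        signed_permute (\<lambda>i. if i = a then c else if i = c then a else i) (\<lambda>i. 1) v $ a
        \<partial>(uniform_sphere :: (real ^ 'n) measure)) =
        (\<integral>v. v $ a * v $ a \<partial>uniform_sphere)"
      by (intro integral_uniform_sphere_signed_permute) auto
    then show ?thesis by (simp add: signed_permute_def)
  qed
  have "real CARD('n) * (\<integral>v. v $ a * v $ a \<partial>(uniform_sphere :: (real ^ 'n) measure)) =
      (\<Sum>c\<in>UNIV. \<integral>v. v $ c * v $ c \<partial>(uniform_sphere :: (real ^ 'n) measure))"
    by (subst sum.cong[OF refl same]) simp_all
  also have "\<dots> = (\<integral>v. (\<Sum>c\<in>UNIV. v $ c * v $ c) \<partial>(uniform_sphere :: (real ^ 'n) measure))"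
    by (rule Bochner_Integration.integral_sum[symmetric]) (rule integrable_uniform_sphere_component)
  also have "\<dots> = (\<integral>v. 1 \<partial>(uniform_sphere :: (real ^ 'n) measure))"
  proof (rule integral_cong_AE)
    show "AE v in (uniform_sphere :: (real ^ 'n) measure). (\<Sum>c\<in>UNIV. v $ c * v $ c) = 1"
      using AE_uniform_sphere
    proof eventually_elim
      case (elim v)
      then show ?case by (simp add: norm_eq_1 inner_vec_def)
    qed
  qed auto
  also have "\<dots> = 1" by (simp add: prob_space)
  finally show ?thesis using True by (simp add: field_simps)
qed

text \<open>The squared inner product is a double sum of products of coordinates; independence
  factors each expectation and the second moments of \<open>V\<close> leave only the diagonal. This
  replaces conditioning on \<open>U\<close>.\<close>

lemma (in prob_space) expectation_inner_uniform_sphere: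
  fixes V U :: "'a \<Rightarrow> real ^ 'n"
  assumes indep: "indep_var borel V borel U"
    and V: "distr M borel V = uniform_sphere"
    and bounded: "AE \<omega> in M. norm (U \<omega>) \<le> B"
  shows "integrable M (\<lambda>\<omega>. (V \<omega> \<bullet> U \<omega>)\<^sup>2)"
    and "integrable M (\<lambda>\<omega>. (norm (U \<omega>))\<^sup>2)"
    and "expectation (\<lambda>\<omega>. (V \<omega> \<bullet> U \<omega>)\<^sup>2) = expectation (\<lambda>\<omega>. (norm (U \<omega>))\<^sup>2) / real CARD('n)"
proof -
  have [measurable]: "V \<in> borel_measurable M" "U \<in> borel_measurable M"
    using indep by (auto dest: indep_var_rv1 indep_var_rv2)
  have intV: "integrable M (\<lambda>\<omega>. V \<omega> $ a * V \<omega> $ b)" for a b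
    using integrable_uniform_sphere_component[of a b]
    unfolding V[symmetric] by (subst (asm) integrable_distr_eq) auto
  have EV: "expectation (\<lambda>\<omega>. V \<omega> $ a * V \<omega> $ b) = (if a = b then 1 / real CARD('n) else 0)" for a b
    using uniform_sphere_second_moment[of a b]
    unfolding V[symmetric] by (subst (asm) integral_distr) auto
  have [measurable]: "(\<lambda>\<omega>. U \<omega> $ a) \<in> borel_measurable M" for a
    by (rule measurable_compose[of U M borel]) auto
  have intU: "integrable M (\<lambda>\<omega>. U \<omega> $ a * U \<omega> $ b)" for a b
  proof -
    have "AE \<omega> in M. norm (U \<omega> $ a * U \<omega> $ b) \<le> B\<^sup>2"
      using bounded
    proof eventually_elim
      case (elim \<omega>)
      then have "(norm (U \<omega>))\<^sup>2 \<le> B\<^sup>2" by (intro power_mono) auto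
      then show ?case using abs_component_product_le[of "U \<omega>" a b] by simp
    qed
    then show ?thesis by (intro integrable_const_bound[of _ "B\<^sup>2"]) auto
  qed
  have ind: "indep_var borel (\<lambda>\<omega>. V \<omega> $ a * V \<omega> $ b) borel (\<lambda>\<omega>. U \<omega> $ a * U \<omega> $ b)" for a b
    using indep_var_compose[OF indep, of "\<lambda>x. x $ a * x $ b" borel "\<lambda>x. x $ a * x $ b" borel]
    by (simp add: comp_def)
  have sq: "(V \<omega> \<bullet> U \<omega>)\<^sup>2 = (\<Sum>a\<in>UNIV. \<Sum>b\<in>UNIV. (V \<omega> $ a * V \<omega> $ b) * (U \<omega> $ a * U \<omega> $ b))" for \<omega>
    unfolding inner_vec_def power2_eq_square sum_product by (simp add: mult_ac)
  have nsq: "(norm (U \<omega>))\<^sup>2 = (\<Sum>a\<in>UNIV. U \<omega> $ a * U \<omega> $ a)" for \<omega>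
    unfolding power2_norm_eq_inner inner_vec_def by simp
  note int = indep_var_integrable[OF ind intV intU]
  show "integrable M (\<lambda>\<omega>. (V \<omega> \<bullet> U \<omega>)\<^sup>2)" unfolding sq by (intro Bochner_Integration.integrable_sum int)
  show "integrable M (\<lambda>\<omega>. (norm (U \<omega>))\<^sup>2)" unfolding nsq by (intro Bochner_Integration.integrable_sum intU)
  have "expectation (\<lambda>\<omega>. (V \<omega> \<bullet> U \<omega>)\<^sup>2) =
      (\<Sum>a\<in>UNIV. \<Sum>b\<in>UNIV. (if a = b then 1 / real CARD('n) else 0) * expectation (\<lambda>\<omega>. U \<omega> $ a * U \<omega> $ b))"
    unfolding sq
    by (simp add: Bochner_Integration.integral_sum Bochner_Integration.integrable_sum int
        indep_var_lebesgue_integral[OF ind intV intU] EV)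
  also have "\<dots> = (\<Sum>a\<in>UNIV. expectation (\<lambda>\<omega>. U \<omega> $ a * U \<omega> $ a)) / real CARD('n)"
    by (simp add: if_distrib[of "\<lambda>x. x * _"] sum.delta' sum_divide_distrib cong: if_cong)
  also have "\<dots> = expectation (\<lambda>\<omega>. (norm (U \<omega>))\<^sup>2) / real CARD('n)"
    unfolding nsq by (simp add: Bochner_Integration.integral_sum intU)
  finally show "expectation (\<lambda>\<omega>. (V \<omega> \<bullet> U \<omega>)\<^sup>2) = expectation (\<lambda>\<omega>. (norm (U \<omega>))\<^sup>2) / real CARD('n)" .
qed

section \<open>Measurability of the iterates\<close>

text \<open>
  A diverging loop has the fixed but unspecified value \<open>the None\<close>, so that the loop is measurable
  without any assumption on termination.
\<close>

lemma repeat_until_eq: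
  "repeat_until c b s =
     (if \<exists>k. b ((c ^^ Suc k) s) then (c ^^ Suc (LEAST k. b ((c ^^ Suc k) s))) s else the None)"
  by (simp add: repeat_until_def while_def while_option_def funpow_swap1)

text \<open>The number of passes is a measurable natural number, so on termination the result is
  selected measurably from countably many measurable iterates.\<close>

lemma measurable_repeat_until:
  assumes c: "\<And>k. (\<lambda>\<omega>. (c \<omega> ^^ Suc k) (s \<omega>)) \<in> M \<rightarrow>\<^sub>M N"
    and b: "Measurable.pred N b" and "the None \<in> space N"
  shows "(\<lambda>\<omega>. repeat_until (c \<omega>) b (s \<omega>)) \<in> M \<rightarrow>\<^sub>M N"
proof -
  have [measurable]: "Measurable.pred M (\<lambda>\<omega>. b ((c \<omega> ^^ Suc k) (s \<omega>)))" for k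
    using measurable_compose[OF c b] .
  have "(\<lambda>\<omega>. (c \<omega> ^^ Suc (LEAST k. b ((c \<omega> ^^ Suc k) (s \<omega>)))) (s \<omega>)) \<in> M \<rightarrow>\<^sub>M N"
    by (rule measurable_compose_countable[OF c]) measurable
  moreover have "(\<lambda>\<omega>. the None) \<in> M \<rightarrow>\<^sub>M N" using assms(3) by simp
  ultimately show ?thesis unfolding repeat_until_eq by (rule measurable_If) measurable
qed

lemma measurable_repeat_aels_step:
  fixes \<phi> :: "'w \<Rightarrow> real \<Rightarrow> real"
  assumes \<phi>: "\<And>g. g \<in> borel_measurable M \<Longrightarrow> (\<lambda>\<omega>. \<phi> \<omega> (g \<omega>)) \<in> borel_measurable M"
    and [measurable]: "\<alpha> \<in> borel_measurable M" "t \<in> borel_measurable M"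
      "u \<in> borel_measurable M" "w \<in> borel_measurable M"
    and b: "Measurable.pred (borel \<Otimes>\<^sub>M borel \<Otimes>\<^sub>M borel) b"
  shows "(\<lambda>\<omega>. repeat_until (aels_step (\<phi> \<omega>) (\<alpha> \<omega>)) b (t \<omega>, u \<omega>, w \<omega>))
    \<in> M \<rightarrow>\<^sub>M borel \<Otimes>\<^sub>M borel \<Otimes>\<^sub>M borel"
proof (rule measurable_repeat_until[OF _ b])
  fix k
  have [measurable]: "(\<lambda>\<omega>. \<phi> \<omega> (\<alpha> \<omega> ^ j * t \<omega>)) \<in> borel_measurable M" for j
    by (rule \<phi>) measurable
  show "(\<lambda>\<omega>. (aels_step (\<phi> \<omega>) (\<alpha> \<omega>) ^^ Suc k) (t \<omega>, u \<omega>, w \<omega>)) \<in> M \<rightarrow>\<^sub>M borel \<Otimes>\<^sub>M borel \<Otimes>\<^sub>M borel"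
    unfolding aels_step_funpow by measurable
qed (simp add: space_pair_measure)

lemma pred_compare_snd:
  "Measurable.pred (borel \<Otimes>\<^sub>M borel \<Otimes>\<^sub>M borel) (\<lambda>(t::real, a, b). a \<le> (b::real))"
  "Measurable.pred (borel \<Otimes>\<^sub>M borel \<Otimes>\<^sub>M borel) (\<lambda>(t::real, a, b). a < (b::real))"
  by measurable

lemma measurable_aels:
  fixes f :: "'a::euclidean_space \<Rightarrow> real"
  assumes f: "continuous_on UNIV f"
    and [measurable]: "x \<in> borel_measurable M" "T \<in> borel_measurable M" "d \<in> borel_measurable M"
  shows "(\<lambda>\<omega>. aels f (x \<omega>) (T \<omega>) \<beta> (d \<omega>)) \<in> borel_measurable M"
proof -
  have f' [measurable]: "f \<in> borel_measurable borel" by (rule borel_measurable_continuous_onI[OF f])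
  define \<phi> where "\<phi> = (\<lambda>\<omega> t. f (x \<omega> + t *\<^sub>R d \<omega>))"
  have \<phi>: "(\<lambda>\<omega>. \<phi> \<omega> (g \<omega>)) \<in> borel_measurable M" if [measurable]: "g \<in> borel_measurable M" for g
    unfolding \<phi>_def by measurable
  define \<alpha> where "\<alpha> = (\<lambda>\<omega>. if \<phi> \<omega> (T \<omega>) \<le> f (x \<omega>) then 1 / \<beta> else \<beta>)"
  have [measurable]: "(\<lambda>\<omega>. \<phi> \<omega> (T \<omega>)) \<in> borel_measurable M" by (rule \<phi>) measurable
  have [measurable]: "\<alpha> \<in> borel_measurable M" unfolding \<alpha>_def by measurable
  define R where "R = (\<lambda>\<omega>. repeat_until (aels_step (\<phi> \<omega>) (\<alpha> \<omega>)) (\<lambda>(t, f_old, f_new). f_new \<ge> f_old)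
    (T \<omega>, f (x \<omega>), \<phi> \<omega> (T \<omega>)))"
  have R [measurable]: "R \<in> M \<rightarrow>\<^sub>M borel \<Otimes>\<^sub>M borel \<Otimes>\<^sub>M borel"
    unfolding R_def by (rule measurable_repeat_aels_step[where \<phi> = \<phi> and \<alpha> = \<alpha>, OF \<phi> _ _ _ _ pred_compare_snd(1)]) auto
  \<comment> \<open>\<open>Q\<close> is defined for every outcome; the case distinction below
    selects it only where the second loop is executed.\<close>
  define Q where "Q = (\<lambda>\<omega>. repeat_until (aels_step (\<phi> \<omega>) \<beta>) (\<lambda>(t, f_old, f_new). f_new > f_old)
    (T \<omega>, snd (snd (R \<omega>)), fst (snd (R \<omega>))))"
  have [measurable]: "Q \<in> M \<rightarrow>\<^sub>M borel \<Otimes>\<^sub>M borel \<Otimes>\<^sub>M borel"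
    unfolding Q_def by (rule measurable_repeat_aels_step[where \<phi> = \<phi> and \<alpha> = "\<lambda>_. \<beta>", OF \<phi> _ _ _ _ pred_compare_snd(2)]) auto
  have "aels f (x \<omega>) (T \<omega>) \<beta> (d \<omega>) =
      (if fst (R \<omega>) = T \<omega> / \<beta> then if \<beta> < 1 then fst (Q \<omega>) else \<beta>\<^sup>2 * fst (Q \<omega>)
       else if \<alpha> \<omega> < 1 then fst (R \<omega>) else \<beta>\<^sup>2 * fst (R \<omega>))" for \<omega>
  proof -
    have \<phi>': "\<phi> \<omega> = (\<lambda>t. f (x \<omega> + t *\<^sub>R d \<omega>))" by (simp only: \<phi>_def)
    have \<alpha>': "\<alpha> \<omega> = (if f (x \<omega> + T \<omega> *\<^sub>R d \<omega>) \<le> f (x \<omega>) then 1 / \<beta> else \<beta>)"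
      by (simp only: \<alpha>_def \<phi>_def)
    note R' = fun_cong[OF R_def, of \<omega>, unfolded \<phi>']
    note Q' = fun_cong[OF Q_def, of \<omega>, unfolded \<phi>']
    show ?thesis
      unfolding aels_def Let_def \<alpha>'[symmetric] R'[symmetric] Q' case_prod_beta
      by (cases "fst (R \<omega>) = T \<omega> / \<beta>") simp_all
  qed
  then show ?thesis by simp
qed

text \<open>The state before iteration \<open>k\<close> involves \<open>d j\<close> for
  \<open>j < k\<close> only, each known at \<open>F (Suc j)\<close> and hence at \<open>F k\<close>.
  This makes the current gradient independent of the next direction.\<close>

lemma measurable_descent_state:
  fixes f :: "'a::euclidean_space \<Rightarrow> real"
  assumes f: "continuous_on UNIV f" and F: "filtration \<Omega> F"
    and d: "\<And>j. d j \<in> borel_measurable (F (Suc j))"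
  shows "(\<lambda>\<omega>. fst (descent_state f T0 \<beta> x0 (\<lambda>i. d i \<omega>) k)) \<in> borel_measurable (F k)
    \<and> (\<lambda>\<omega>. snd (descent_state f T0 \<beta> x0 (\<lambda>i. d i \<omega>) k)) \<in> borel_measurable (F k)"
proof (induction k)
  case (Suc k)
  have "subalgebra (F (Suc k)) (F k)"
    using filtration.space_F[OF F] filtration.sets_F_mono[OF F, of k "Suc k"]
    by (simp add: subalgebra_def)
  note lift = measurable_from_subalg[OF this]
  let ?s = "\<lambda>\<omega>. descent_state f T0 \<beta> x0 (\<lambda>i. d i \<omega>) k"
  let ?t = "\<lambda>\<omega>. aels f (fst (?s \<omega>)) (snd (?s \<omega>) / \<beta>) \<beta> (d k \<omega>)"
  have [measurable]: "(\<lambda>\<omega>. fst (?s \<omega>)) \<in> borel_measurable (F (Suc k))"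
    "(\<lambda>\<omega>. snd (?s \<omega>)) \<in> borel_measurable (F (Suc k))"
    using Suc lift by blast+
  note [measurable] = d[of k]
  have [measurable]: "?t \<in> borel_measurable (F (Suc k))"
    by (rule measurable_aels[OF f]) measurable
  have "(\<lambda>\<omega>. fst (?s \<omega>) + ?t \<omega> *\<^sub>R d k \<omega>) \<in> borel_measurable (F (Suc k))" by measurable
  then show ?case by (simp add: Let_def case_prod_beta)
qed simp

text \<open>Preimages under \<open>Y\<close> belong to \<open>G\<close>, so independence restricts
  to them; being closed under intersection, the preimage families pass it on to the generated
  sigma-algebras.\<close>

lemma (in prob_space) indep_var_subalgebra:
  assumes X: "X \<in> borel_measurable M"
    and indep: "indep_set {X -` A \<inter> space M | A. A \<in> sets borel} (sets G)"
    and G: "subalgebra M G" and Y: "Y \<in> borel_measurable G"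
  shows "indep_var borel X borel Y"
  unfolding indep_var_eq
proof (intro conjI indep_set_sigma_sets X)
  show "Y \<in> borel_measurable M" using measurable_from_subalg[OF G Y] .
  show "indep_set {X -` A \<inter> space M | A. A \<in> sets borel} {Y -` A \<inter> space M | A. A \<in> sets borel}"
    unfolding indep_set_def
  proof (rule indep_sets_mono_sets[OF indep[unfolded indep_set_def]])
    fix b :: bool
    have "{Y -` A \<inter> space M | A. A \<in> sets borel} \<subseteq> sets G"
      using Y G by (auto simp: subalgebra_def dest: measurable_sets)
    then show "case_bool {X -` A \<inter> space M | A. A \<in> sets borel} {Y -` A \<inter> space M | A. A \<in> sets borel} b
        \<subseteq> case_bool {X -` A \<inter> space M | A. A \<in> sets borel} (sets G) b"
      by (cases b) auto
  qed
  have stable: "Int_stable {Z -` A \<inter> space M | A. A \<in> sets borel}" for Z :: "'a \<Rightarrow> 'z::topological_space"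
  proof (rule Int_stableI, safe)
    fix A B :: "'z set" assume "A \<in> sets borel" "B \<in> sets borel"
    then show "\<exists>C. (Z -` A \<inter> space M) \<inter> (Z -` B \<inter> space M) = Z -` C \<inter> space M \<and> C \<in> sets borel"
      by (intro exI[of _ "A \<inter> B"]) auto
  qed
  show "Int_stable {X -` A \<inter> space M | A. A \<in> sets borel}" by (rule stable)
  show "Int_stable {Y -` A \<inter> space M | A. A \<in> sets borel}" by (rule stable)
qed

section \<open>Random and finite-difference directions\<close>

text \<open>A random direction has a favourable angle only on average, so the contraction is proved
  for the expected gap \<open>E\<close> instead of along each path.\<close>

lemma random_direction_rate:
  fixes f :: "real ^ 'n \<Rightarrow> real" and M :: "'w measure"
  assumes "aels_descent f grad m L xs T0 \<beta>" and "prob_space M"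
    and v: "\<And>j. distr M borel (v j) = uniform_sphere"
    and na: "nonanticipating M F v \<mu>"
    and d: "\<And>j \<omega>. d j \<omega> = - (\<mu> j \<omega> *\<^sub>R v j \<omega>)"
    and descent: "\<And>j. j < k \<Longrightarrow>
      AE \<omega> in M. d j \<omega> \<bullet> grad (iterate f T0 \<beta> x0 (\<lambda>i. d i \<omega>) j) < 0"
  shows "integrable M (\<lambda>\<omega>. f (iterate f T0 \<beta> x0 (\<lambda>i. d i \<omega>) k) - f xs)"
    and "prob_space.expectation M (\<lambda>\<omega>. f (iterate f T0 \<beta> x0 (\<lambda>i. d i \<omega>) k) - f xs)
      \<le> (1 - \<beta>\<^sup>2 / real CARD('n) * (1 - sqrt (1 - m / L))) ^ k * (f x0 - f xs)"
proof -
  interpret aels_descent f grad m L xs T0 \<beta> x0 by fact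
  interpret prob_space M by fact
  define x where "x = (\<lambda>j \<omega>. iter (\<lambda>i. d i \<omega>) j)"
  define n where "n = real CARD('n)"
  have n: "1 \<le> n" by (simp add: n_def Suc_le_eq)
  have F: "filtration (space M) F" and sub: "subalgebra M (F j)"
    and vF: "v j \<in> borel_measurable (F (Suc j))" and muF: "\<mu> j \<in> borel_measurable (F (Suc j))"
    and indep: "indep_set {v j -` A \<inter> space M | A. A \<in> sets borel} (sets (F j))" for j
    using na by (auto simp: nonanticipating_def)
  have vM [measurable]: "v j \<in> borel_measurable M" for j
    using measurable_from_subalg[OF sub vF] .
  have dF: "d j \<in> borel_measurable (F (Suc j))" for j
    unfolding d[abs_def] using vF muF by simp
  have xF: "x j \<in> borel_measurable (F j)" for j
    using measurable_descent_state[OF continuous_f F dF, where k = j]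
    by (simp add: x_def iterate_def)
  have [measurable]: "x j \<in> borel_measurable M" for j
    using measurable_from_subalg[OF sub xF] .
  have [measurable]: "f \<in> borel_measurable borel" "grad \<in> borel_measurable borel"
    by (auto intro: borel_measurable_continuous_onI continuous_f continuous_grad)
  have desc: "AE \<omega> in M. \<forall>j<k. d j \<omega> \<bullet> grad (x j \<omega>) < 0"
    using descent unfolding x_def by (simp add: AE_all_countable)
  \<comment> \<open>Monotone decrease bounds the gap and, through \<open>norm_grad_upper\<close>,
    the gradient; this provides all integrability below.\<close>
  have le_start: "AE \<omega> in M. f (x j \<omega>) \<le> f x0" if "j \<le> k" for j
    using desc
  proof eventually_elim
    case (elim \<omega>)
    then show ?case unfolding x_def using that by (intro iterate_le_start) auto
  qed
  have int: "integrable M (\<lambda>\<omega>. f (x j \<omega>) - f xs)" if "j \<le> k" for j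
  proof (rule integrable_const_bound)
    show "AE \<omega> in M. norm (f (x j \<omega>) - f xs) \<le> f x0 - f xs"
      using le_start[OF that] by eventually_elim (simp add: f_min)
  qed measurable
  define E where "E = (\<lambda>j. expectation (\<lambda>\<omega>. f (x j \<omega>) - f xs))"
  have E_nonneg: "0 \<le> E j" for j
    unfolding E_def by (intro Bochner_Integration.integral_nonneg) (simp add: f_min)
  define r where "r = 1 - \<beta>\<^sup>2 / n * (1 - sqrt (1 - m / L))"
  have r: "0 \<le> r" using rate_bounds(2)[of "1 / n"] n by (simp add: r_def)
  have step: "E (Suc j) \<le> r * E j" if "j < k" for j
  proof -
    let ?g = "\<lambda>\<omega>. grad (x j \<omega>)"
    have "AE \<omega> in M. norm (?g \<omega>) \<le> sqrt (2 * L * (f x0 - f xs))"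
      using le_start[OF less_imp_le[OF that]]
    proof eventually_elim
      case (elim \<omega>)
      have "(norm (?g \<omega>))\<^sup>2 \<le> 2 * L * (f x0 - f xs)"
        using elim that L_pos by (intro order_trans[OF norm_grad_upper] mult_left_mono) auto
      then show ?case by (rule real_le_rsqrt)
    qed
    note bounded = this
    have ind: "indep_var borel (v j) borel ?g"
      using indep_var_subalgebra[OF vM indep sub] xF[of j] by simp
    have sq: "integrable M (\<lambda>\<omega>. (v j \<omega> \<bullet> ?g \<omega>)\<^sup>2)" "integrable M (\<lambda>\<omega>. (norm (?g \<omega>))\<^sup>2)"
      "expectation (\<lambda>\<omega>. (v j \<omega> \<bullet> ?g \<omega>)\<^sup>2) = expectation (\<lambda>\<omega>. (norm (?g \<omega>))\<^sup>2) / n"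
      unfolding n_def by (rule expectation_inner_uniform_sphere[OF ind v bounded])+
    have "AE u in distr M borel (v j). norm u = 1"
      unfolding v by (rule AE_uniform_sphere)
    then have unit: "AE \<omega> in M. norm (v j \<omega>) = 1"
      by (subst (asm) AE_distr_iff) auto
    have "AE \<omega> in M. f (x (Suc j) \<omega>) - f xs \<le> (f (x j \<omega>) - f xs) - \<beta>\<^sup>2 / (2 * L) * (v j \<omega> \<bullet> ?g \<omega>)\<^sup>2"
      using desc unit
    proof eventually_elim
      case (elim \<omega>)
      \<comment> \<open>Strict descent excludes a zero multiplier, so its square cancels in the
        decrease and only the unit vector \<open>v j \<omega>\<close> remains.\<close>
      have "\<mu> j \<omega> \<noteq> 0" using elim(1) that by (auto simp: d)
      have "f (x (Suc j) \<omega>) \<le> f (x j \<omega>) - \<beta>\<^sup>2 * ((d j \<omega> \<bullet> ?g \<omega>)\<^sup>2 / (2 * L * (norm (d j \<omega>))\<^sup>2))"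
        unfolding x_def using elim(1) that by (intro iterate_decrease) (auto simp: x_def)
      also have "(d j \<omega> \<bullet> ?g \<omega>)\<^sup>2 / (2 * L * (norm (d j \<omega>))\<^sup>2) = (v j \<omega> \<bullet> ?g \<omega>)\<^sup>2 / (2 * L)"
        using \<open>\<mu> j \<omega> \<noteq> 0\<close> elim(2) by (simp add: d power_mult_distrib)
      finally show ?case by simp
    qed
    then have "E (Suc j) \<le> expectation (\<lambda>\<omega>. (f (x j \<omega>) - f xs) - \<beta>\<^sup>2 / (2 * L) * (v j \<omega> \<bullet> ?g \<omega>)\<^sup>2)"
      unfolding E_def using that
      by (intro integral_mono_AE Bochner_Integration.integrable_diff integrable_mult_right int sq(1)) auto
    also have "\<dots> = E j - \<beta>\<^sup>2 / (2 * L) * (expectation (\<lambda>\<omega>. (norm (?g \<omega>))\<^sup>2) / n)"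
      unfolding E_def sq(3)[symmetric] using that
      by (subst Bochner_Integration.integral_diff) (auto intro!: int sq(1) integrable_mult_right)
    also have "\<dots> \<le> E j - \<beta>\<^sup>2 / (2 * L) * (2 * m * E j / n)"
    proof -
      have "2 * m * E j = expectation (\<lambda>\<omega>. 2 * m * (f (x j \<omega>) - f xs))"
        unfolding E_def by simp
      also have "\<dots> \<le> expectation (\<lambda>\<omega>. (norm (?g \<omega>))\<^sup>2)"
        using that by (intro integral_mono integrable_mult_right int sq(2) polyak_lojasiewicz) auto
      finally show ?thesis
        using L_pos n by (intro diff_left_mono mult_left_mono divide_right_mono) auto
    qed
    also have "\<dots> = (1 - \<beta>\<^sup>2 / n * (m / L)) * E j"
      using L_pos n by (simp add: field_simps)
    also have "\<dots> \<le> r * E j"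
      unfolding r_def using n sqrt_rate E_nonneg
      by (intro mult_right_mono diff_left_mono mult_left_mono) auto
    finally show ?thesis .
  qed
  have "E j \<le> r ^ j * (f x0 - f xs)" if "j \<le> k" for j
    using that
  proof (induction j)
    case 0
    then show ?case by (simp add: E_def x_def iterate_0 prob_space)
  next
    case (Suc j)
    then have "E (Suc j) \<le> r * (r ^ j * (f x0 - f xs))"
      using step[of j] r by (intro order_trans[OF step] mult_left_mono) auto
    then show ?case by simp
  qed
  then have "E k \<le> r ^ k * (f x0 - f xs)" by simp
  then show "expectation (\<lambda>\<omega>. f (iter (\<lambda>i. d i \<omega>) k) - f xs)
      \<le> (1 - \<beta>\<^sup>2 / real CARD('n) * (1 - sqrt (1 - m / L))) ^ k * (f x0 - f xs)"
    by (simp add: E_def x_def r_def n_def)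
  show "integrable M (\<lambda>\<omega>. f (iter (\<lambda>i. d i \<omega>) k) - f xs)"
    using int[of k] by (simp add: x_def)
qed

text \<open>At distance at least \<Delta> from the minimiser the gradient norm is at least
  \<open>m * \<Delta>\<close>, so the absolute error becomes a relative error \<open>s\<close> and
  \<open>linear_rate\<close> applies with \<open>c = 1 - s\<^sup>2\<close>.\<close>

lemma finite_difference_rate:
  fixes f :: "real ^ 'n \<Rightarrow> real"
  assumes "aels_descent f grad m L xs T0 \<beta>"
    and s: "0 < s" "s < 1" and \<Delta>: "0 < \<Delta>"
    and \<sigma>: "\<sigma> = 2 * s * m * \<Delta> / (L * sqrt (real CARD('n)))"
    and d: "\<And>j. j < k \<Longrightarrow> d j = - fd_gradient f \<sigma> (iterate f T0 \<beta> x0 d j)"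
    and descent: "\<And>j. j < k \<Longrightarrow> d j \<bullet> grad (iterate f T0 \<beta> x0 d j) < 0"
    and far: "\<And>j. j < k \<Longrightarrow> \<Delta> \<le> norm (iterate f T0 \<beta> x0 d j - xs)"
  shows "f (iterate f T0 \<beta> x0 d k) - f xs
    \<le> (1 - \<beta>\<^sup>2 * (1 - s\<^sup>2) * (1 - sqrt (1 - m / L))) ^ k * (f x0 - f xs)"
proof -
  interpret aels_descent f grad m L xs T0 \<beta> x0 by fact
  have "0 < \<sigma>" using s \<Delta> m_pos L_pos by (simp add: \<sigma>)
  \<comment> \<open>The spacing \<sigma> is calibrated to make the error bound of
    \<open>fd_gradient_error\<close> exactly \<open>s * (m * \<Delta>)\<close>.\<close>
  have \<sigma>': "L * \<sigma> / 2 * sqrt (real CARD('n)) = s * (m * \<Delta>)"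
    using L_pos by (simp add: \<sigma>)
  show ?thesis
  proof (rule linear_rate)
    fix j assume j: "j < k"
    let ?x = "iter d j"
    have "norm (fd_gradient f \<sigma> ?x - grad ?x) \<le> s * (m * \<Delta>)"
      using fd_gradient_error[OF smooth_strongly_convex_axioms \<open>0 < \<sigma>\<close>, of ?x] by (simp only: \<sigma>')
    also have "\<dots> \<le> s * norm (grad ?x)"
      using norm_grad_lower[of ?x] far[OF j] m_pos s
      by (intro mult_left_mono) (auto intro: order_trans[OF mult_left_mono])
    finally show "(1 - s\<^sup>2) * ((norm (d j))\<^sup>2 * (norm (grad ?x))\<^sup>2) \<le> (d j \<bullet> grad ?x)\<^sup>2"
      using perturbed_angle[of "fd_gradient f \<sigma> ?x" "grad ?x" s] s by (simp add: d[OF j])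
  qed (use s descent in \<open>auto simp: power_le_one\<close>)
qed

text \<open>The finite-difference claim bounds iterate \<open>Suc k\<close> by a \<open>k\<close>-th
  power, so one factor at most one is given away.\<close>

lemma power_Suc_le_power_mono:
  fixes a b :: real
  assumes "0 \<le> a" "a \<le> 1" "a \<le> b"
  shows "a ^ Suc k \<le> b ^ k"
proof -
  have "a ^ Suc k \<le> a ^ k" using assms by (intro power_decreasing) auto
  also have "\<dots> \<le> b ^ k" using assms by (intro power_mono) auto
  finally show ?thesis .
qed

section \<open>Combination of the three rates\<close>

theorem theorem1:
  fixes f :: "real ^ 'n \<Rightarrow> real" and grad :: "real ^ 'n \<Rightarrow> real ^ 'n"
    and x0 xs :: "real ^ 'n" and m L T0 \<beta> :: real
  assumes "strongly_convex m f grad"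
    and "L-lipschitz_on UNIV grad"
    and "is_arg_min f (\<lambda>_. True) xs"
    and "0 < T0" and "0 < \<beta>" and "\<beta> < 1"
  shows
    "(\<forall>d k.
        (\<forall>j<k. d j = - grad (iterate f T0 \<beta> x0 d j) \<and>
               d j \<bullet> grad (iterate f T0 \<beta> x0 d j) < 0) \<longrightarrow>
        f (iterate f T0 \<beta> x0 d k) - f xs
          \<le> (1 - \<beta>\<^sup>2 * (1 - sqrt (1 - m / L))) ^ k * (f x0 - f xs))
   \<and>
     (\<forall>d k \<Delta> \<sigma>' \<sigma>.
        0 < \<Delta> \<and> 0 < \<sigma>' \<and> \<sigma>' < 1 \<and> \<sigma> = 2 * \<sigma>' * m * \<Delta> / (L * sqrt (real CARD('n))) \<and>
        (\<forall>j\<le>k. d j = - fd_gradient f \<sigma> (iterate f T0 \<beta> x0 d j) \<and>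
               d j \<bullet> grad (iterate f T0 \<beta> x0 d j) < 0 \<and>
               norm (iterate f T0 \<beta> x0 d j - xs) \<ge> \<Delta>) \<longrightarrow>
        f (iterate f T0 \<beta> x0 d (Suc k)) - f xs
          \<le> min
              ((1 - \<beta>\<^sup>2 * (1 - sqrt (1 - m / L)) * ((1 - \<sigma>') / (1 + \<sigma>')\<^sup>2)) ^ k * (f x0 - f xs)
                 + \<sigma>' * (1 + \<sigma>')\<^sup>2 * \<Delta> * L * norm (x0 - xs)
                     / ((1 - \<sigma>')\<^sup>2 * \<beta>\<^sup>2 * (1 - sqrt (1 - m / L))))
              ((1 - \<beta>\<^sup>2 / 2 * (1 - sqrt (1 - m / L)) * ((1 - \<sigma>') / (1 + \<sigma>')\<^sup>2)) ^ k * (f x0 - f xs)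
                 + \<sigma>'\<^sup>2 * m * (1 + \<sigma>')\<^sup>2 * \<Delta>\<^sup>2
                     / ((1 - \<sigma>')\<^sup>2 * \<beta>\<^sup>2 * (1 - sqrt (1 - m / L)))))
   \<and>
     (\<forall>(M :: 'w measure) F v \<mu> d k.
        prob_space M \<and>
        prob_space.indep_vars M (\<lambda>_. borel) v UNIV \<and>
        (\<forall>j. distr M borel (v j) = uniform_sphere) \<and>
        nonanticipating M F v \<mu> \<and>
        (\<forall>j \<omega>. d j \<omega> = - (\<mu> j \<omega> *\<^sub>R v j \<omega>)) \<and>
        (\<forall>j<k. AE \<omega> in M.
           sgn (\<mu> j \<omega>) = sgn (v j \<omega> \<bullet> grad (iterate f T0 \<beta> x0 (\<lambda>i. d i \<omega>) j)) \<and>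
           d j \<omega> \<bullet> grad (iterate f T0 \<beta> x0 (\<lambda>i. d i \<omega>) j) < 0) \<longrightarrow>
        integrable M (\<lambda>\<omega>. f (iterate f T0 \<beta> x0 (\<lambda>i. d i \<omega>) k) - f xs) \<and>
        prob_space.expectation M (\<lambda>\<omega>. f (iterate f T0 \<beta> x0 (\<lambda>i. d i \<omega>) k) - f xs)
          \<le> (1 - \<beta>\<^sup>2 / real CARD('n) * (1 - sqrt (1 - m / L))) ^ k * (f x0 - f xs))"
proof -
  interpret aels_descent f grad m L xs T0 \<beta> x0
    using assms by unfold_locales
  define q where "q = 1 - sqrt (1 - m / L)"
  have q: "0 < q" using sqrt_rate by (simp add: q_def)
  show ?thesis
  proof (intro conjI allI impI)
    fix d k
    assume d: "\<forall>j<k. d j = - grad (iter d j) \<and> d j \<bullet> grad (iter d j) < 0"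
    \<comment> \<open>Direction and gradient are antiparallel, so the squared cosine is one and
      \<open>c = 1\<close>.\<close>
    have "f (iter d k) - f xs \<le> (1 - \<beta>\<^sup>2 * 1 * (1 - sqrt (1 - m / L))) ^ k * (f x0 - f xs)"
    proof (rule linear_rate)
      fix j assume "j < k"
      then have dj: "d j = - grad (iter d j)" using d by blast
      show "1 * ((norm (d j))\<^sup>2 * (norm (grad (iter d j)))\<^sup>2) \<le> (d j \<bullet> grad (iter d j))\<^sup>2"
        unfolding dj by (simp add: dot_square_norm power2_eq_square)
    qed (use d in auto)
    then show "f (iter d k) - f xs \<le> (1 - \<beta>\<^sup>2 * (1 - sqrt (1 - m / L))) ^ k * (f x0 - f xs)"
      by simp
  next
    fix d :: "nat \<Rightarrow> real ^ 'n" and k \<Delta> s \<sigma>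
    assume a: "0 < \<Delta> \<and> 0 < s \<and> s < 1 \<and> \<sigma> = 2 * s * m * \<Delta> / (L * sqrt (real CARD('n))) \<and>
        (\<forall>j\<le>k. d j = - fd_gradient f \<sigma> (iter d j) \<and>
               d j \<bullet> grad (iter d j) < 0 \<and> norm (iter d j - xs) \<ge> \<Delta>)"
    then have s: "0 < s" "s < 1" "0 < \<Delta>" by auto
    define p where "p = (1 - s) / (1 + s)\<^sup>2"
    let ?a = "1 - \<beta>\<^sup>2 * (1 - s\<^sup>2) * q"
    have rate: "f (iter d (Suc k)) - f xs \<le> ?a ^ Suc k * (f x0 - f xs)"
      unfolding q_def
      by (rule finite_difference_rate[where \<Delta> = \<Delta> and \<sigma> = \<sigma>, OF aels_descent_axioms])
        (use a[folded less_Suc_eq_le] in blast)+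
    have s2: "0 \<le> s\<^sup>2" "s\<^sup>2 \<le> 1" using s by (auto simp: power_le_one)
    have a_bounds: "0 \<le> ?a" "?a \<le> 1"
      using rate_bounds[of "1 - s\<^sup>2"] s2 by (auto simp: q_def)
    have p: "0 \<le> p" "p \<le> 1 - s\<^sup>2"
    proof -
      show "0 \<le> p" using s by (simp add: p_def)
      \<comment> \<open>The denominator \<open>(1 + s)\<^sup>2\<close> is at least one, and
        \<open>s\<^sup>2 \<le> s\<close> does the rest.\<close>
      have "p \<le> (1 - s) / 1"
        unfolding p_def using s by (intro divide_left_mono) (auto simp: one_le_power)
      also have "(1 - s) / 1 \<le> 1 - s\<^sup>2" using s by (simp add: power2_eq_square mult_left_le)
      finally show "p \<le> 1 - s\<^sup>2" .
    qed
    have "\<beta>\<^sup>2 * q * p \<le> \<beta>\<^sup>2 * q * (1 - s\<^sup>2)"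
      using p q by (intro mult_left_mono) auto
    moreover have "0 \<le> \<beta>\<^sup>2 * q * p" using p q by simp
    ultimately have le: "?a \<le> 1 - \<beta>\<^sup>2 * q * p" "?a \<le> 1 - \<beta>\<^sup>2 / 2 * q * p"
      by (auto simp: mult_ac)
    \<comment> \<open>Enlarging the factor, dropping one power and adding a nonnegative
      \<open>e\<close> all weaken \<open>rate\<close>; both arguments of \<open>min\<close> have
      this form.\<close>
    have bound: "f (iter d (Suc k)) - f xs \<le> b ^ k * (f x0 - f xs) + e"
      if "?a \<le> b" "0 \<le> e" for b e
    proof -
      have "?a ^ Suc k * (f x0 - f xs) \<le> b ^ k * (f x0 - f xs)"
        using power_Suc_le_power_mono[OF a_bounds that(1), of k] f_min[of x0] by (intro mult_right_mono) auto
      then show ?thesis using rate that(2) by linarith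
    qed
    have "0 \<le> s * (1 + s)\<^sup>2 * \<Delta> * L * norm (x0 - xs) / ((1 - s)\<^sup>2 * \<beta>\<^sup>2 * q)"
      "0 \<le> s\<^sup>2 * m * (1 + s)\<^sup>2 * \<Delta>\<^sup>2 / ((1 - s)\<^sup>2 * \<beta>\<^sup>2 * q)"
      using s q L_pos m_pos by auto
    note bound[OF le(1) this(1)] bound[OF le(2) this(2)]
    then show "f (iter d (Suc k)) - f xs
          \<le> min
              ((1 - \<beta>\<^sup>2 * (1 - sqrt (1 - m / L)) * ((1 - s) / (1 + s)\<^sup>2)) ^ k * (f x0 - f xs)
                 + s * (1 + s)\<^sup>2 * \<Delta> * L * norm (x0 - xs)
                     / ((1 - s)\<^sup>2 * \<beta>\<^sup>2 * (1 - sqrt (1 - m / L))))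
              ((1 - \<beta>\<^sup>2 / 2 * (1 - sqrt (1 - m / L)) * ((1 - s) / (1 + s)\<^sup>2)) ^ k * (f x0 - f xs)
                 + s\<^sup>2 * m * (1 + s)\<^sup>2 * \<Delta>\<^sup>2
                     / ((1 - s)\<^sup>2 * \<beta>\<^sup>2 * (1 - sqrt (1 - m / L))))"
      unfolding q_def p_def by (rule min.boundedI)
  next
    fix M :: "'w measure" and F v \<mu> d k
    assume a: "prob_space M \<and>
        prob_space.indep_vars M (\<lambda>_. borel) v UNIV \<and>
        (\<forall>j. distr M borel (v j) = uniform_sphere) \<and>
        nonanticipating M F v \<mu> \<and>
        (\<forall>j \<omega>. d j \<omega> = - (\<mu> j \<omega> *\<^sub>R v j \<omega>)) \<and>
        (\<forall>j<k. AE \<omega> in M.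
           sgn (\<mu> j \<omega>) = sgn (v j \<omega> \<bullet> grad (iter (\<lambda>i. d i \<omega>) j)) \<and>
           d j \<omega> \<bullet> grad (iter (\<lambda>i. d i \<omega>) j) < 0)"
    then have h: "prob_space M" "\<And>j. distr M borel (v j) = uniform_sphere" "nonanticipating M F v \<mu>"
      "\<And>j \<omega>. d j \<omega> = - (\<mu> j \<omega> *\<^sub>R v j \<omega>)"
      by blast+
    have descent: "AE \<omega> in M. d j \<omega> \<bullet> grad (iter (\<lambda>i. d i \<omega>) j) < 0" if "j < k" for j
    proof -
      have "AE \<omega> in M. sgn (\<mu> j \<omega>) = sgn (v j \<omega> \<bullet> grad (iter (\<lambda>i. d i \<omega>) j)) \<and>
          d j \<omega> \<bullet> grad (iter (\<lambda>i. d i \<omega>) j) < 0"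
        using a that by blast
      then show ?thesis by (rule eventually_mono) blast
    qed
    note rate = random_direction_rate[where d = d and k = k, OF aels_descent_axioms h descent]
    show "integrable M (\<lambda>\<omega>. f (iter (\<lambda>i. d i \<omega>) k) - f xs)" by (rule rate(1))
    show "prob_space.expectation M (\<lambda>\<omega>. f (iter (\<lambda>i. d i \<omega>) k) - f xs)
          \<le> (1 - \<beta>\<^sup>2 / real CARD('n) * (1 - sqrt (1 - m / L))) ^ k * (f x0 - f xs)"
      by (rule rate(2))
  qed
qed

end
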